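(* Let $\nu\in\mathcal{M}(\Phi)$ and assume that $0\in\mathbb{R}^d$ is a $\sigma$-point of $\nu$ with value $\ell\in\mathbb{C}$. (i) If $d\in\{1,2,3,4\}$, then $$\lim_{|x|<\alpha t\to0}\mathbb{P}_t\nu(x)=\ell,\qquad\forall\,\alpha>0.\qquad( * )$$ (ii) If $d\ge5$, then $( * )$ holds under the additional assumption $$\lim_{r\to0^+}\frac{|\nu-\ell\,dy|(B_r(0))}{r^{d-4}}=0.$$
   Context: Fix $d\ge1$. A locally finite complex measure in $\mathbb{R}^d$ is $\nu=\nu_1+i\nu_2$ where $\nu_1,\nu_2$ are signed Borel measures which are finite on compact sets; $|\nu|$ denotes its total variation (a positive Borel measure, finite on compact sets). $dy$ denotes Lebesgue measure, $|E|$ the Lebesgue measure of $E$, $B_r(x)=\{y\in\mathbb{R}^d:|y-x|<r\}$; for $\ell\in\mathbb{C}$, $\nu-\ell\,dy$ is the locally finite complex measure $E\mapsto\nu(E)-\ell|E|$ (for bounded Borel $E$). $\sigma$-point: $0$ is a $\sigma$-point of $\nu$ with value $\ell\in\mathbb{C}$ if $$\lim_{|x|+r\to0}\frac{|(\nu-\ell\,dy)(B_r(x))|}{(|x|+r)^d}=0,$$ the limit being over $x\in\mathbb{R}^d$, $r>0$. Poisson–Hermite semigroup: let $L=-\Delta+|x|^2$ be the Hermite operator in $\mathbb{R}^d$ and $\mathbb{P}_t=e^{-t\sqrt L}=\frac{t}{\sqrt{4\pi}}\int_0^\infty e^{-t^2/(4\tau)}e^{-\tau L}\frac{d\tau}{\tau^{3/2}}$,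 $t>0$. Its integral kernel is $$\mathbb{P}_t(x,y)=c_d\,t\int_0^1\frac{e^{-t^2/\kappa(s)}(1-s^2)^{\frac d2-1}e^{-\frac14\left(\frac{|x-y|^2}{s}+s|x+y|^2\right)}}{s^{d/2}\,\kappa(s)^{3/2}}\,ds,\qquad \kappa(s)=2\ln\frac{1+s}{1-s},$$ where $c_d=8(4\pi)^{-(d+1)/2}>0$. Let $\Phi(y)=\dfrac{e^{-|y|^2/2}}{(1+|y|)^{d/2}[\log(e+|y|)]^{3/2}}$, and let $\mathcal{M}(\Phi)$ be the set of locally finite complex measures $\nu$ in $\mathbb{R}^d$ with $\int_{\mathbb{R}^d}\Phi\,d|\nu|<\infty$. For $\nu\in\mathcal{M}(\Phi)$ set $\mathbb{P}_t\nu(x)=\int_{\mathbb{R}^d}\mathbb{P}_t(x,y)\,d\nu(y)$, which converges absolutely for all $t>0$, $x\in\mathbb{R}^d$. The notation $\lim_{|x|<\alpha t\to0}$ means the limit as $(t,x)\to(0,0)$ over points $(t,x)\in(0,\infty)\times\mathbb{R}^d$ with $|x|<\alpha t$. *)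

theory Defs
  imports "HOL-Analysis.Analysis"
begin

text \<open>
  A locally finite signed or complex measure on the Euclidean space \<open>'a\<close> of dimension
  \<open>d = DIM('a)\<close> is represented by its values on bounded Borel sets, since it need not have a
  value on an unbounded set.  The values of the set function at other sets are arbitrary, and
  no definition below depends on them.
\<close>

definition lf_signed_measure :: "('a::euclidean_space set \<Rightarrow> real) \<Rightarrow> bool" where
  "lf_signed_measure \<nu> \<longleftrightarrow>
     (\<forall>A :: nat \<Rightarrow> 'a set. range A \<subseteq> sets borel \<longrightarrow> disjoint_family A \<longrightarrow> bounded (\<Union>i. A i) \<longrightarrow>
        (\<lambda>i. \<nu> (A i)) sums \<nu> (\<Union>i. A i))"

definition lf_complex_measure :: "('a::euclidean_space set \<Rightarrow> complex) \<Rightarrow> bool" where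
  "lf_complex_measure \<nu> \<longleftrightarrow>
     lf_signed_measure (\<lambda>E. Re (\<nu> E)) \<and> lf_signed_measure (\<lambda>E. Im (\<nu> E))"

definition total_variation :: "('a::euclidean_space set \<Rightarrow> complex) \<Rightarrow> 'a set \<Rightarrow> ennreal" where
  "total_variation \<nu> E =
     (SUP P \<in> {P. finite P \<and> disjoint P \<and> (\<forall>A\<in>P. A \<in> sets borel \<and> bounded A \<and> A \<subseteq> E)}.
        \<Sum>A\<in>P. ennreal (cmod (\<nu> A)))"

definition variation_measure :: "('a::euclidean_space set \<Rightarrow> complex) \<Rightarrow> 'a measure" where
  "variation_measure \<nu> = measure_of UNIV (sets borel) (total_variation \<nu>)"

text \<open>
  The upper variation of a signed measure is the positive part of its Jordan decomposition;
  the negative part is the upper variation of \<open>- \<nu>\<close>.  Negative values of \<open>\<nu> F\<close> are cut off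
  by \<^const>\<open>ennreal\<close>, which does not change the supremum as \<open>F = {}\<close> is admitted.
\<close>

definition upper_variation :: "('a::euclidean_space set \<Rightarrow> real) \<Rightarrow> 'a set \<Rightarrow> ennreal" where
  "upper_variation \<nu> E = (SUP F \<in> {F \<in> sets borel. bounded F \<and> F \<subseteq> E}. ennreal (\<nu> F))"

definition jordan_pos :: "('a::euclidean_space set \<Rightarrow> real) \<Rightarrow> 'a measure" where
  "jordan_pos \<nu> = measure_of UNIV (sets borel) (upper_variation \<nu>)"

definition jordan_neg :: "('a::euclidean_space set \<Rightarrow> real) \<Rightarrow> 'a measure" where
  "jordan_neg \<nu> = jordan_pos (\<lambda>E. - \<nu> E)"

definition complex_measure_integral ::
    "('a::euclidean_space set \<Rightarrow> complex) \<Rightarrow> ('a \<Rightarrow> complex) \<Rightarrow> complex" where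
  "complex_measure_integral \<nu> f =
     ((LINT y|jordan_pos (\<lambda>E. Re (\<nu> E)). f y) - (LINT y|jordan_neg (\<lambda>E. Re (\<nu> E)). f y))
     + \<i> * ((LINT y|jordan_pos (\<lambda>E. Im (\<nu> E)). f y) - (LINT y|jordan_neg (\<lambda>E. Im (\<nu> E)). f y))"

text \<open>
  The two set functions handed to \<^const>\<open>measure_of\<close> are indeed measures, so that
  \<^const>\<open>variation_measure\<close> and \<^const>\<open>jordan_pos\<close> are not the default zero measure.
\<close>

lemma SUP_add_SUP_le_ennreal:
  fixes f :: "'b \<Rightarrow> ennreal" and g :: "'c \<Rightarrow> ennreal"
  assumes "I \<noteq> {}" "J \<noteq> {}" "\<And>i j. i \<in> I \<Longrightarrow> j \<in> J \<Longrightarrow> f i + g j \<le> c"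
  shows "(SUP i\<in>I. f i) + (SUP j\<in>J. g j) \<le> c"
proof -
  have "f i + (SUP j\<in>J. g j) \<le> c" if "i \<in> I" for i
    using assms that by (subst ennreal_SUP_add_right) (auto intro!: SUP_least)
  then show ?thesis
    using assms by (subst ennreal_SUP_add_left[symmetric]) (auto intro!: SUP_least)
qed

lemma countably_additive_borelI:
  fixes u :: "'a::euclidean_space set \<Rightarrow> ennreal"
  assumes mono: "\<And>E F. E \<subseteq> F \<Longrightarrow> u E \<le> u F"
    and super: "\<And>E F. E \<in> sets borel \<Longrightarrow> F \<in> sets borel \<Longrightarrow> E \<inter> F = {} \<Longrightarrow> u E + u F \<le> u (E \<union> F)"
    and sub: "\<And>A :: nat \<Rightarrow> 'a set. range A \<subseteq> sets borel \<Longrightarrow> disjoint_family A \<Longrightarrow>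
                u (\<Union>i. A i) \<le> (\<Sum>i. u (A i))"
    and empty: "u {} = 0"
  shows "countably_additive (sets borel) u"
  unfolding countably_additive_def
proof (intro allI impI antisym)
  fix A :: "nat \<Rightarrow> 'a set"
  assume A: "range A \<subseteq> sets borel" "disjoint_family A"
  show "u (\<Union>i. A i) \<le> (\<Sum>i. u (A i))"
    using A by (rule sub)
  have fin: "(\<Sum>i<n. u (A i)) \<le> u (\<Union>i<n. A i)" for n
  proof (induction n)
    case (Suc n)
    have "A i \<inter> A n = {}" if "i < n" for i
      using A(2) that by (simp add: disjoint_family_on_def)
    then have "(\<Union>i<n. A i) \<inter> A n = {}"
      by auto
    moreover have "(\<Union>i<n. A i) \<in> sets borel" "A n \<in> sets borel"
      using A(1) by auto
    ultimately have "u (\<Union>i<n. A i) + u (A n) \<le> u ((\<Union>i<n. A i) \<union> A n)"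
      by (intro super)
    then have "(\<Sum>i<n. u (A i)) + u (A n) \<le> u ((\<Union>i<n. A i) \<union> A n)"
      by (rule order_trans[OF add_right_mono[OF Suc]])
    then show ?case
      by (simp add: lessThan_Suc Un_commute add.commute)
  qed (simp add: empty)
  show "(\<Sum>i. u (A i)) \<le> u (\<Union>i. A i)"
  proof (rule suminf_le_const)
    show "(\<Sum>i<n. u (A i)) \<le> u (\<Union>i. A i)" for n
      by (rule order_trans[OF fin]) (auto intro!: mono)
  qed simp
qed

lemma lf_signed_measure_empty: "lf_signed_measure \<nu> \<Longrightarrow> \<nu> {} = 0"
proof -
  assume "lf_signed_measure \<nu>"
  from this[unfolded lf_signed_measure_def, rule_format, of "\<lambda>_. {}"]
  have "(\<lambda>i::nat. \<nu> {}) sums \<nu> {}"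
    by (simp add: disjoint_family_on_def)
  then show "\<nu> {} = 0"
    using summable_const_iff sums_summable by blast
qed

lemma lf_signed_measure_Un:
  assumes \<nu>: "lf_signed_measure \<nu>" and EF: "E \<in> sets borel" "F \<in> sets borel" "bounded E" "bounded F"
    and dis: "E \<inter> F = {}"
  shows "\<nu> (E \<union> F) = \<nu> E + \<nu> F"
proof -
  have "disjoint_family (binaryset E F)"
    using dis unfolding disjoint_family_on_def binaryset_def by (auto simp: fun_upd_apply split: if_splits)
  moreover have "range (binaryset E F) \<subseteq> sets borel" "bounded (\<Union>i. binaryset E F i)"
    using EF by (simp_all add: range_binaryset_eq UN_binaryset_eq)
  ultimately have "(\<lambda>i. \<nu> (binaryset E F i)) sums \<nu> (\<Union>i. binaryset E F i)"
    using \<nu> by (simp add: lf_signed_measure_def)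
  moreover have "(\<lambda>i. \<nu> (binaryset E F i)) sums (\<nu> E + \<nu> F)"
    by (rule binaryset_sums) (rule lf_signed_measure_empty[OF \<nu>])
  ultimately show ?thesis
    by (metis UN_binaryset_eq sums_unique2)
qed

lemma sums_ennreal_le:
  assumes "f sums s"
  shows "ennreal s \<le> (\<Sum>i. ennreal (f i))"
proof (rule LIMSEQ_le_const2)
  show "(\<lambda>n. ennreal (\<Sum>i<n. f i)) \<longlonglongrightarrow> ennreal s"
    using assms by (intro tendsto_ennrealI) (simp add: sums_def)
  have "ennreal (\<Sum>i<n. f i) \<le> (\<Sum>i<n. ennreal (f i))" for n
  proof (induction n)
    case (Suc n)
    have "ennreal ((\<Sum>i<n. f i) + f n) \<le> ennreal (\<Sum>i<n. f i) + ennreal (f n)"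
      by (cases "0 \<le> (\<Sum>i<n. f i)"; cases "0 \<le> f n")
         (simp_all add: ennreal_neg ennreal_leI flip: ennreal_plus)
    also have "\<dots> \<le> (\<Sum>i<n. ennreal (f i)) + ennreal (f n)"
      by (rule add_right_mono) (rule Suc)
    finally show ?case
      by simp
  qed simp
  then show "\<exists>N. \<forall>n\<ge>N. ennreal (\<Sum>i<n. f i) \<le> (\<Sum>i. ennreal (f i))"
    by (intro exI[of _ 0] allI impI order_trans[OF _ sum_le_suminf[OF summableI]]) auto
qed

lemma emeasure_jordan_pos:
  assumes \<nu>: "lf_signed_measure \<nu>" and "E \<in> sets borel"
  shows "emeasure (jordan_pos \<nu>) E = upper_variation \<nu> E"
  unfolding jordan_pos_def
proof (rule emeasure_measure_of_sigma)
  note emp = lf_signed_measure_empty[OF \<nu>]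
  have u0: "upper_variation \<nu> {} = 0"
    unfolding upper_variation_def by (intro antisym SUP_least) (simp_all add: emp)
  show "sigma_algebra UNIV (sets borel :: 'a set set)"
    by (metis sets.sigma_algebra_axioms space_borel)
  show "positive (sets borel) (upper_variation \<nu>)"
    by (simp add: positive_def u0)
  show "countably_additive (sets borel) (upper_variation \<nu>)"
  proof (rule countably_additive_borelI)
    show "upper_variation \<nu> E \<le> upper_variation \<nu> F" if "E \<subseteq> F" for E F
      unfolding upper_variation_def using that by (intro SUP_subset_mono) auto
    show "upper_variation \<nu> {} = 0" by fact
  next
    fix E F :: "'a set"
    assume dis: "E \<inter> F = {}"
    show "upper_variation \<nu> E + upper_variation \<nu> F \<le> upper_variation \<nu> (E \<union> F)"
      unfolding upper_variation_def[of \<nu> E] upper_variation_def[of \<nu> F]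
    proof (rule SUP_add_SUP_le_ennreal)
      fix G H
      assume "G \<in> {G \<in> sets borel. bounded G \<and> G \<subseteq> E}" "H \<in> {H \<in> sets borel. bounded H \<and> H \<subseteq> F}"
      then have GH: "G \<in> sets borel" "bounded G" "G \<subseteq> E" "H \<in> sets borel" "bounded H" "H \<subseteq> F"
        by auto
      have up: "ennreal (\<nu> K) \<le> upper_variation \<nu> (E \<union> F)"
        if "K \<in> sets borel" "bounded K" "K \<subseteq> E \<union> F" for K
        unfolding upper_variation_def using that by (intro SUP_upper) auto
      have "G \<inter> H = {}" using GH dis by auto
      then have "\<nu> (G \<union> H) = \<nu> G + \<nu> H"
        using GH by (intro lf_signed_measure_Un[OF \<nu>])
      moreover have "G \<union> H \<subseteq> E \<union> F" "G \<subseteq> E \<union> F" "H \<subseteq> E \<union> F" using GH by auto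
      ultimately show "ennreal (\<nu> G) + ennreal (\<nu> H) \<le> upper_variation \<nu> (E \<union> F)"
        using up[of G] up[of H] up[of "G \<union> H"] GH
        by (cases "\<nu> G \<ge> 0"; cases "\<nu> H \<ge> 0") (simp_all add: ennreal_neg)
    next
      have "{} \<in> {F \<in> sets borel. bounded F \<and> F \<subseteq> K}" for K :: "'a set"
        by simp
      then show "{G \<in> sets borel. bounded G \<and> G \<subseteq> E} \<noteq> {}" "{H \<in> sets borel. bounded H \<and> H \<subseteq> F} \<noteq> {}"
        by blast+
    qed
  next
    fix A :: "nat \<Rightarrow> 'a set"
    assume A: "range A \<subseteq> sets borel" "disjoint_family A"
    show "upper_variation \<nu> (\<Union>i. A i) \<le> (\<Sum>i. upper_variation \<nu> (A i))"
      unfolding upper_variation_def[of \<nu> "\<Union>i. A i"]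
    proof (rule SUP_least)
      fix F assume F: "F \<in> {F \<in> sets borel. bounded F \<and> F \<subseteq> (\<Union>i. A i)}"
      then have Feq: "(\<Union>i. F \<inter> A i) = F" by auto
      have "(\<lambda>i. \<nu> (F \<inter> A i)) sums \<nu> (\<Union>i. F \<inter> A i)"
      proof (rule \<nu>[unfolded lf_signed_measure_def, rule_format])
        show "disjoint_family (\<lambda>i. F \<inter> A i)"
          using A(2) by (auto simp: disjoint_family_on_def)
      qed (use F A(1) in \<open>auto simp: Feq\<close>)
      then have "ennreal (\<nu> F) \<le> (\<Sum>i. ennreal (\<nu> (F \<inter> A i)))"
        unfolding Feq by (rule sums_ennreal_le)
      also have "\<dots> \<le> (\<Sum>i. upper_variation \<nu> (A i))"
      proof (rule suminf_le)
        show "ennreal (\<nu> (F \<inter> A i)) \<le> upper_variation \<nu> (A i)" for i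
          unfolding upper_variation_def
          by (rule SUP_upper) (use F A in \<open>auto intro: bounded_subset\<close>)
      qed simp_all
      finally show "ennreal (\<nu> F) \<le> (\<Sum>i. upper_variation \<nu> (A i))" .
    qed
  qed
qed (rule assms(2))

lemma lf_complex_measure_sums:
  assumes "lf_complex_measure \<nu>" "range A \<subseteq> sets borel" "disjoint_family A" "bounded (\<Union>i. A i)"
  shows "(\<lambda>i::nat. \<nu> (A i)) sums \<nu> (\<Union>i. A i)"
  using assms by (subst sums_complex_iff) (auto simp: lf_complex_measure_def lf_signed_measure_def)

lemma cmod_sums_le:
  assumes "f sums s"
  shows "ennreal (cmod s) \<le> (\<Sum>i. ennreal (cmod (f i)))"
proof (rule LIMSEQ_le_const2)
  show "(\<lambda>n. ennreal (cmod (\<Sum>i<n. f i))) \<longlonglongrightarrow> ennreal (cmod s)"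
    using assms by (intro tendsto_ennrealI tendsto_norm) (simp add: sums_def)
  have "ennreal (cmod (\<Sum>i<n. f i)) \<le> (\<Sum>i<n. ennreal (cmod (f i)))" for n
    by (simp add: sum_nonneg ennreal_leI norm_sum)
  then show "\<exists>N. \<forall>n\<ge>N. ennreal (cmod (\<Sum>i<n. f i)) \<le> (\<Sum>i. ennreal (cmod (f i)))"
    by (intro exI[of _ 0] allI impI order_trans[OF _ sum_le_suminf[OF summableI]]) auto
qed

lemma emeasure_variation_measure:
  assumes \<nu>: "lf_complex_measure \<nu>" and "E \<in> sets borel"
  shows "emeasure (variation_measure \<nu>) E = total_variation \<nu> E"
  unfolding variation_measure_def
proof (rule emeasure_measure_of_sigma)
  let ?P = "\<lambda>E. {P. finite P \<and> disjoint P \<and> (\<forall>A\<in>P. A \<in> sets borel \<and> bounded A \<and> A \<subseteq> E)}"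
  have emp: "\<nu> {} = 0"
    using \<nu> lf_signed_measure_empty[of "\<lambda>E. Re (\<nu> E)"] lf_signed_measure_empty[of "\<lambda>E. Im (\<nu> E)"]
    by (simp add: lf_complex_measure_def complex_eq_iff)
  have P0: "(\<Sum>A\<in>P. ennreal (cmod (\<nu> A))) = 0" if "P \<in> ?P {}" for P
    using that emp by (intro sum.neutral) auto
  have u0: "total_variation \<nu> {} = 0"
    unfolding total_variation_def by (intro antisym SUP_least) (use P0 in auto)
  show "sigma_algebra UNIV (sets borel :: 'a set set)"
    by (metis sets.sigma_algebra_axioms space_borel)
  show "positive (sets borel) (total_variation \<nu>)"
    by (simp add: positive_def u0)
  show "countably_additive (sets borel) (total_variation \<nu>)"
  proof (rule countably_additive_borelI)
    show "total_variation \<nu> E \<le> total_variation \<nu> F" if "E \<subseteq> F" for E F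
      unfolding total_variation_def using that by (intro SUP_subset_mono) auto
    show "total_variation \<nu> {} = 0" by fact
  next
    fix E F :: "'a set"
    assume dis: "E \<inter> F = {}"
    show "total_variation \<nu> E + total_variation \<nu> F \<le> total_variation \<nu> (E \<union> F)"
      unfolding total_variation_def[of \<nu> E] total_variation_def[of \<nu> F]
    proof (rule SUP_add_SUP_le_ennreal)
      fix P Q assume PQ: "P \<in> ?P E" "Q \<in> ?P F"
      have PQd: "A \<inter> B = {}" if "A \<in> P" "B \<in> Q" for A B
        using PQ that dis by fastforce
      have "\<forall>A\<in>P \<inter> Q. ennreal (cmod (\<nu> A)) = 0"
        using PQd emp by force
      then have "(\<Sum>A\<in>P. ennreal (cmod (\<nu> A))) + (\<Sum>A\<in>Q. ennreal (cmod (\<nu> A)))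
          = (\<Sum>A\<in>P \<union> Q. ennreal (cmod (\<nu> A)))"
        using PQ by (intro sum.union_inter_neutral[symmetric]) auto
      also have "\<dots> \<le> total_variation \<nu> (E \<union> F)"
        unfolding total_variation_def
      proof (rule SUP_upper)
        have "disjoint (P \<union> Q)"
          using PQ PQd by (intro disjoint_union) auto
        then show "P \<union> Q \<in> ?P (E \<union> F)" using PQ by auto
      qed
      finally show "(\<Sum>A\<in>P. ennreal (cmod (\<nu> A))) + (\<Sum>A\<in>Q. ennreal (cmod (\<nu> A)))
          \<le> total_variation \<nu> (E \<union> F)" .
    next
      have "{} \<in> ?P K" for K :: "'a set"
        by simp
      then show "?P E \<noteq> {}" "?P F \<noteq> {}"
        by blast+
    qed
  next
    fix A :: "nat \<Rightarrow> 'a set"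
    assume A: "range A \<subseteq> sets borel" "disjoint_family A"
    show "total_variation \<nu> (\<Union>i. A i) \<le> (\<Sum>i. total_variation \<nu> (A i))"
      unfolding total_variation_def[of \<nu> "\<Union>i. A i"]
    proof (rule SUP_least)
      fix P assume P: "P \<in> ?P (\<Union>i. A i)"
      have "(\<Sum>F\<in>P. ennreal (cmod (\<nu> F))) \<le> (\<Sum>F\<in>P. \<Sum>i. ennreal (cmod (\<nu> (F \<inter> A i))))"
      proof (rule sum_mono)
        fix F assume F: "F \<in> P"
        then have Feq: "(\<Union>i. F \<inter> A i) = F" using P by auto
        have "(\<lambda>i. \<nu> (F \<inter> A i)) sums \<nu> (\<Union>i. F \<inter> A i)"
          using F P A by (intro lf_complex_measure_sums[OF \<nu>]) (auto simp: disjoint_family_on_def Feq)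
        then show "ennreal (cmod (\<nu> F)) \<le> (\<Sum>i. ennreal (cmod (\<nu> (F \<inter> A i))))"
          unfolding Feq by (rule cmod_sums_le)
      qed
      also have "\<dots> = (\<Sum>i. \<Sum>F\<in>P. ennreal (cmod (\<nu> (F \<inter> A i))))"
        by (rule suminf_sum[symmetric]) simp
      also have "\<dots> \<le> (\<Sum>i. total_variation \<nu> (A i))"
      proof (rule suminf_le)
        fix i
        let ?Q = "(\<lambda>F. F \<inter> A i) ` P"
        have dis: "F \<inter> G = {}" if "F \<in> P" "G \<in> P" "F \<noteq> G" for F G
          using P that by (auto simp: disjoint_def)
        have "(\<Sum>F\<in>P. ennreal (cmod (\<nu> (F \<inter> A i)))) = (\<Sum>G\<in>?Q. ennreal (cmod (\<nu> G)))"
        proof (rule sum.reindex_nontrivial[symmetric, unfolded o_def])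
          show "finite P" using P by simp
          fix F G assume "F \<in> P" "G \<in> P" "F \<noteq> G" "F \<inter> A i = G \<inter> A i"
          then have "F \<inter> A i = {}" using dis[of F G] by auto
          then show "ennreal (cmod (\<nu> (F \<inter> A i))) = 0" by (simp add: emp)
        qed
        also have "\<dots> \<le> total_variation \<nu> (A i)"
          unfolding total_variation_def
        proof (rule SUP_upper)
          have "disjoint ?Q"
          proof (rule disjointI)
            fix X Y assume "X \<in> ?Q" "Y \<in> ?Q" "X \<noteq> Y"
            then obtain F G where "F \<in> P" "G \<in> P" "X = F \<inter> A i" "Y = G \<inter> A i" "F \<noteq> G" by auto
            then show "X \<inter> Y = {}" using dis[of F G] by auto
          qed
          then show "?Q \<in> ?P (A i)"
            using P A(1) by (auto intro: bounded_subset)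
        qed
        finally show "(\<Sum>F\<in>P. ennreal (cmod (\<nu> (F \<inter> A i)))) \<le> total_variation \<nu> (A i)" .
      qed simp_all
      finally show "(\<Sum>F\<in>P. ennreal (cmod (\<nu> F))) \<le> (\<Sum>i. total_variation \<nu> (A i))" .
    qed
  qed
qed (rule assms(2))

definition minus_lebesgue ::
    "('a::euclidean_space set \<Rightarrow> complex) \<Rightarrow> complex \<Rightarrow> 'a set \<Rightarrow> complex" where
  "minus_lebesgue \<nu> l E = \<nu> E - l * complex_of_real (measure lborel E)"

text \<open>For \<open>r > 0\<close>, the condition \<open>norm x + r \<rightarrow> 0\<close> means \<open>(x, r) \<rightarrow> (0, 0)\<close>.\<close>

definition sigma_point_zero :: "('a::euclidean_space set \<Rightarrow> complex) \<Rightarrow> complex \<Rightarrow> bool" where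
  "sigma_point_zero \<nu> l \<longleftrightarrow>
     ((\<lambda>(x, r). cmod (minus_lebesgue \<nu> l (ball x r)) / (norm x + r) ^ DIM('a)) \<longlongrightarrow> 0)
       (at (0, 0) within UNIV \<times> {0<..})"

definition kappa :: "real \<Rightarrow> real" where
  "kappa s = 2 * ln ((1 + s) / (1 - s))"

text \<open>
  The kernel of \<open>exp (- t * sqrt L)\<close>, \<open>L = - \<Delta> + |x|\<^sup>2\<close>: insert Mehler's formula for the heat kernel
  of \<open>L\<close> into the subordination formula
  \<open>exp (- t * sqrt L) = t / sqrt (4 * pi) * (\<integral>\<tau>>0. exp (- t\<^sup>2 / (4 * \<tau>)) * exp (- \<tau> * L) * \<tau> powr (- 3/2) d\<tau>)\<close>
  and substitute \<open>s = tanh \<tau>\<close>, so that \<open>4 * \<tau> = kappa s\<close>.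
\<close>

definition poisson_hermite_kernel :: "real \<Rightarrow> 'a::euclidean_space \<Rightarrow> 'a \<Rightarrow> real" where
  "poisson_hermite_kernel t x y =
     8 * (4 * pi) powr (- ((real DIM('a) + 1) / 2)) * t *
     (LBINT s:{0<..<1}.
        exp (- t\<^sup>2 / kappa s) * (1 - s\<^sup>2) powr (real DIM('a) / 2 - 1)
        * exp (- (1/4) * ((norm (x - y))\<^sup>2 / s + s * (norm (x + y))\<^sup>2))
        / (s powr (real DIM('a) / 2) * kappa s powr (3/2)))"

definition Phi :: "'a::euclidean_space \<Rightarrow> real" where
  "Phi y = exp (- (norm y)\<^sup>2 / 2)
     / ((1 + norm y) powr (real DIM('a) / 2) * ln (exp 1 + norm y) powr (3/2))"

definition M_Phi :: "('a::euclidean_space set \<Rightarrow> complex) set" where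
  "M_Phi = {\<nu>. lf_complex_measure \<nu> \<and> (\<integral>\<^sup>+ y. ennreal (Phi y) \<partial>variation_measure \<nu>) < \<infinity>}"

definition poisson_hermite ::
    "real \<Rightarrow> ('a::euclidean_space set \<Rightarrow> complex) \<Rightarrow> 'a \<Rightarrow> complex" where
  "poisson_hermite t \<nu> x =
     complex_measure_integral \<nu> (\<lambda>y. complex_of_real (poisson_hermite_kernel t x y))"

definition nontangential_limit_zero ::
    "real \<Rightarrow> (real \<Rightarrow> 'a::euclidean_space \<Rightarrow> complex) \<Rightarrow> complex \<Rightarrow> bool" where
  "nontangential_limit_zero \<alpha> u l \<longleftrightarrow>
     ((\<lambda>(t, x). u t x) \<longlongrightarrow> l) (at (0, 0) within {(t, x). 0 < t \<and> norm x < \<alpha> * t})"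

end

theory Submission
  imports Defs
begin

text \<open>
  Write \<open>\<mu> = \<nu> - l dy\<close> and \<open>d = DIM('a)\<close>.  After subordination the Poisson-Hermite kernel is an average over
  \<open>s \<in> (0, 1)\<close>, with respect to a probability measure depending on \<open>t\<close>, of Mehler kernels.  As a
  function of \<open>y\<close> each Mehler kernel is a Gaussian, hence radially decreasing, about a point \<open>\<beta> x\<close> with
  \<open>0 < \<beta> < 1\<close> depending on \<open>s\<close> (\<open>mehler_kernel_gaussian\<close>).  So the whole kernel is a superposition of
  indicators of balls, whose centres \<open>z\<close> satisfy \<open>|z| \<le> |x|\<close> but need not coincide with \<open>x\<close>
  (\<open>nn_integral_poisson_density\<close>).  This is exactly what a \<open>\<sigma>\<close>-point speaks about: on all small balls near the
  origin \<open>|\<mu> (ball z r)| \<le> \<epsilon> * (|z| + r) ^ d\<close>.  Averaging this bound gives at most \<open>C * \<epsilon>\<close>, provided that the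
  average of \<open>(|z| + r) ^ d\<close> stays bounded.  The part \<open>r ^ d\<close> is controlled by the total integral of the kernel,
  which is at most 1; the part \<open>|z| ^ d \<le> |x| ^ d\<close> by \<open>P_t(0, 0) = O(t ^ (- d))\<close> and \<open>|x| < \<alpha> * t\<close>
  (\<open>ball_average_growth\<close>).

  Large balls are removed by truncation (\<open>poisson_truncation\<close>).  The mass at distance at least \<open>\<eta>\<close> from the
  origin contributes \<open>O(t)\<close>, because there \<open>P_t(x, y) \<le> C * t * Phi y\<close> for small \<open>x\<close> (\<open>poisson_density_tail\<close>).
  Finally the integral of the kernel against Lebesgue measure tends to 1 (\<open>poisson_of_one\<close>), which accounts for
  \<open>l dy\<close>.

  The argument is carried out for positive measures and extended nonnegative integrals, so that no
  integrability has to be discussed on the way: a comparison of measures on small balls, with an error, yields the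
  comparison of their Poisson integrals (\<open>poisson_comparison\<close>).  It is applied in both directions to the positive
  and negative parts of \<open>Re \<nu>\<close> and \<open>Im \<nu>\<close>, a multiple of Lebesgue measure being added to one side.
\<close>

section \<open>The law of the Mehler time under Poisson subordination\<close>

lemma kappa_pos: "0 < s \<Longrightarrow> s < 1 \<Longrightarrow> 0 < kappa s"
  unfolding kappa_def by (simp add: field_simps)

lemma kappa_measurable [measurable]: "kappa \<in> borel_measurable borel"
  unfolding kappa_def[abs_def] by measurable

lemma kappa_has_derivative:
  assumes "0 < s" "s < 1"
  shows "(kappa has_real_derivative 4 / (1 - s\<^sup>2)) (at s within S)"
proof -
  have "1 - s\<^sup>2 = (1 - s) * (1 + s)" by (simp add: power2_eq_square algebra_simps)
  with assms show ?thesis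
    unfolding kappa_def[abs_def]
    by (auto intro!: derivative_eq_intros simp: divide_simps)
qed

lemma kappa_strict_mono:
  assumes "0 < s" "s < s'" "s' < 1"
  shows "kappa s < kappa s'"
proof -
  have "(1 + s) / (1 - s) < (1 + s') / (1 - s')"
    using assms by (simp add: divide_simps) (simp add: algebra_simps)
  moreover have "0 < (1 + s) / (1 - s)" using assms by simp
  ultimately show ?thesis
    using assms by (simp add: kappa_def)
qed

lemma kappa_inverse:
  assumes "0 < k"
  defines "w \<equiv> exp (k / 2)"
  shows "kappa ((w - 1) / (w + 1)) = k" "0 < (w - 1) / (w + 1)" "(w - 1) / (w + 1) < 1"
proof -
  have w: "1 < w" using assms by simp
  then have w': "1 + w \<noteq> 0" by linarith
  have "(1 + (w - 1) / (w + 1)) / (1 - (w - 1) / (w + 1)) = w"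
    using w w' by (simp add: divide_simps)
  then show "kappa ((w - 1) / (w + 1)) = k"
    unfolding kappa_def by (simp add: w_def)
  show "0 < (w - 1) / (w + 1)" "(w - 1) / (w + 1) < 1" using w by simp_all
qed

text \<open>
  In the variable \<open>\<tau> = kappa s / 4\<close> this is the one-sided \<open>1/2\<close>-stable (Levy) density
  \<open>t / sqrt (4 * pi) * exp (- t\<^sup>2 / (4 * \<tau>)) * \<tau> powr (- 3/2)\<close> of the subordination formula; the factor
  \<open>4 / (1 - s\<^sup>2)\<close> is the derivative of \<^const>\<open>kappa\<close>.
\<close>

definition levy_density :: "real \<Rightarrow> real \<Rightarrow> real" where
  "levy_density t s = t * exp (- t\<^sup>2 / kappa s) * kappa s powr (- (3/2)) * (4 / (1 - s\<^sup>2)) / sqrt pi"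

definition poisson_clock :: "real \<Rightarrow> real measure" where
  "poisson_clock t = density lborel (\<lambda>s. ennreal (indicator {0<..<1} s * levy_density t s))"

lemma levy_density_nonneg:
  assumes "0 \<le> t" "0 < s" "s < 1"
  shows "0 \<le> levy_density t s"
proof -
  have "0 < 1 - s\<^sup>2" using assms by (simp add: power_less_one_iff)
  then show ?thesis using assms by (simp add: levy_density_def)
qed

lemma levy_density_measurable [measurable]: "levy_density t \<in> borel_measurable borel"
  unfolding levy_density_def[abs_def] by measurable

lemma sets_poisson_clock [measurable_cong, simp]: "sets (poisson_clock t) = sets borel"
  by (simp add: poisson_clock_def)

lemma space_poisson_clock [simp]: "space (poisson_clock t) = UNIV"
  by (simp add: poisson_clock_def)

lemma nn_integral_poisson_clock:
  assumes "f \<in> borel_measurable borel"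
  shows "(\<integral>\<^sup>+ s. f s \<partial>poisson_clock t)
    = (\<integral>\<^sup>+ s. ennreal (indicator {0<..<1} s * levy_density t s) * f s \<partial>lborel)"
  using assms unfolding poisson_clock_def by (subst nn_integral_density) auto

lemma AE_poisson_clock: "AE s in poisson_clock t. 0 < s \<and> s < 1"
  unfolding poisson_clock_def by (subst AE_density) (auto intro!: AE_I2 split: split_indicator_asm)

text \<open>
  The substitution \<open>v = t\<^sup>2 / kappa s\<close> turns the total mass into \<open>Gamma (1/2) / sqrt pi\<close>.
\<close>

lemma poisson_clock_total:
  assumes t: "0 < t"
  shows "emeasure (poisson_clock t) UNIV = 1"
proof -
  define g where "g s = t\<^sup>2 / kappa s" for s
  define g' where "g' s = - (t\<^sup>2 * (4 / (1 - s\<^sup>2)) / (kappa s)\<^sup>2)" for s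
  define f :: "real \<Rightarrow> real" where "f v = v powr (1/2 - 1) / exp v" for v
  have g_deriv: "(g has_real_derivative g' s) (at s within {0<..<1})" if "s \<in> {0<..<1}" for s
    unfolding g_def[abs_def] g'_def using that kappa_pos[of s]
    by (auto intro!: derivative_eq_intros kappa_has_derivative simp: power2_eq_square)
  have g_inj: "inj_on g {0<..<1}"
  proof (rule linorder_inj_onI)
    fix s s' :: real assume "s < s'" "s \<in> {0<..<1}" "s' \<in> {0<..<1}"
    then have "0 < kappa s" "kappa s < kappa s'" by (auto intro: kappa_pos kappa_strict_mono)
    then show "g s \<noteq> g s'" using t by (simp add: g_def)
  qed auto
  have g_img: "g ` {0<..<1} = {0<..}"
  proof (intro antisym subsetI)
    fix v :: real assume "v \<in> {0<..}"
    then have v: "0 < v" by simp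
    define w where "w = exp (t\<^sup>2 / v / 2)"
    have k: "0 < t\<^sup>2 / v" using t v by simp
    have "g ((w - 1) / (w + 1)) = v"
      unfolding g_def w_def kappa_inverse(1)[OF k] using t v by simp
    then show "v \<in> g ` {0<..<1}"
      using kappa_inverse(2,3)[OF k] unfolding w_def[symmetric] by (intro image_eqI[of _ _ "(w - 1) / (w + 1)"]) auto
  qed (use t in \<open>auto simp: g_def kappa_pos\<close>)
  have "(f has_integral Gamma (1/2)) {0..}"
    unfolding f_def by (rule Gamma_integral_real) simp
  then have "(f has_integral Gamma (1/2)) {0<..}"
    by (subst has_integral_spike_set_eq[of _ "{0..}"]) (auto intro!: negligible_subset[OF negligible_sing[of 0]])
  then have "f absolutely_integrable_on g ` {0<..<1} \<and> integral (g ` {0<..<1}) f = sqrt pi"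
    unfolding g_img by (auto intro!: nonnegative_absolutely_integrable_1 simp: f_def has_integral_iff Gamma_one_half_real)
  then have sub: "(\<lambda>s. \<bar>g' s\<bar> * f (g s)) absolutely_integrable_on {0<..<1} \<and>
      integral {0<..<1} (\<lambda>s. \<bar>g' s\<bar> * f (g s)) = sqrt pi"
    by (subst has_absolute_integral_change_of_variables_1'[OF _ g_deriv g_inj]) auto
  then have "((\<lambda>s. \<bar>g' s\<bar> * f (g s)) has_integral sqrt pi) {0<..<1}"
    by (simp add: has_integral_iff set_lebesgue_integral_eq_integral(1))
  then have "((\<lambda>s. \<bar>g' s\<bar> * f (g s) / sqrt pi) has_integral sqrt pi / sqrt pi) {0<..<1}"
    by (intro has_integral_divide)
  moreover have eq: "\<bar>g' s\<bar> * f (g s) / sqrt pi = levy_density t s" if "s \<in> {0<..<1}" for s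
  proof -
    have k: "0 < kappa s" and s2: "0 < 1 - s\<^sup>2"
      using that kappa_pos[of s] by (auto simp: power_less_one_iff)
    have p1: "(t\<^sup>2 / kappa s) powr (1/2 - 1) = kappa s powr (1/2) / t"
    proof -
      have "(t\<^sup>2 / kappa s) powr (1/2 - 1) = t\<^sup>2 powr (- (1/2)) / kappa s powr (- (1/2))"
        using k t by (simp add: powr_divide)
      also have "t\<^sup>2 powr (- (1/2)) = 1 / t"
        using t by (simp add: powr_minus powr_half_sqrt divide_simps)
      finally show ?thesis by (simp add: powr_minus divide_simps)
    qed
    have p2: "kappa s powr (1/2) / (kappa s)\<^sup>2 = kappa s powr (- (3/2))"
    proof -
      have "kappa s powr (1/2) / kappa s powr 2 = kappa s powr (1/2 - 2)"
        by (rule powr_diff[symmetric])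
      then show ?thesis using k by simp
    qed
    have "\<bar>g' s\<bar> = t\<^sup>2 * (4 / (1 - s\<^sup>2)) / (kappa s)\<^sup>2"
      using k s2 by (simp add: g'_def)
    moreover have "f (g s) = kappa s powr (1/2) / t * exp (- t\<^sup>2 / kappa s)"
      unfolding f_def g_def p1 minus_divide_left[symmetric] exp_minus by (rule divide_inverse)
    moreover have "t\<^sup>2 * D / K * (R / t * E) / P = t * E * (R / K) * D / P" for D K R E P :: real
      using t by (simp add: power2_eq_square)
    ultimately show ?thesis
      unfolding levy_density_def p2[symmetric] by (simp only:)
  qed
  ultimately have "(levy_density t has_integral 1) {0<..<1}"
    by (subst has_integral_cong[OF eq[symmetric]]) auto
  then have "(\<integral>\<^sup>+ s. indicator {0<..<1} s * levy_density t s \<partial>lborel) = 1"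
    using t by (subst nn_integral_has_integral_lebesgue[where I=1]) (auto intro: levy_density_nonneg)
  then show ?thesis
    unfolding poisson_clock_def by (subst emeasure_density) (auto)
qed

lemma levy_density_le:
  assumes t: "0 \<le> t" and s: "0 < s0" "s0 \<le> s" "s < 1"
  shows "levy_density t s \<le> t * exp (1 / kappa s0) * levy_density 1 s"
proof -
  have k: "0 < kappa s0" "kappa s0 \<le> kappa s"
    using s kappa_pos[of s0] kappa_strict_mono[of s0 s] by (cases "s0 = s"; auto)+
  have s2: "0 < 1 - s\<^sup>2" using s by (simp add: power_less_one_iff)
  have "exp (- t\<^sup>2 / kappa s) \<le> exp (1 / kappa s0) * exp (- 1\<^sup>2 / kappa s)"
  proof -
    have "- t\<^sup>2 / kappa s \<le> 0" using k by simp
    moreover have "1 / kappa s \<le> 1 / kappa s0" using k by (simp add: frac_le)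
    ultimately have "- t\<^sup>2 / kappa s \<le> 1 / kappa s0 + - 1\<^sup>2 / kappa s" by simp
    then show ?thesis by (simp add: exp_add[symmetric])
  qed
  then have "t * exp (- t\<^sup>2 / kappa s) * (kappa s powr (- (3/2)) * (4 / (1 - s\<^sup>2)) / sqrt pi)
      \<le> t * (exp (1 / kappa s0) * exp (- 1\<^sup>2 / kappa s)) * (kappa s powr (- (3/2)) * (4 / (1 - s\<^sup>2)) / sqrt pi)"
    using t s2 by (intro mult_right_mono mult_left_mono) auto
  then show ?thesis by (simp add: levy_density_def mult_ac)
qed

text \<open>
  As \<open>t\<close> tends to 0 the clock concentrates at \<open>s = 0\<close>: away from 0 the densities for \<open>t\<close> and for 1
  differ by the factor \<open>t\<close> and a bounded one, and the density for 1 has mass 1.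
\<close>

lemma poisson_clock_large_times:
  assumes t: "0 < t" and s0: "0 < s0"
  shows "emeasure (poisson_clock t) {s0..} \<le> ennreal (t * exp (1 / kappa s0))"
proof -
  have "emeasure (poisson_clock t) {s0..}
      = (\<integral>\<^sup>+ s. ennreal (indicator {0<..<1} s * levy_density t s) * indicator {s0..} s \<partial>lborel)"
    unfolding poisson_clock_def by (rule emeasure_density) auto
  also have "\<dots> \<le> (\<integral>\<^sup>+ s. ennreal (t * exp (1 / kappa s0)) * ennreal (indicator {0<..<1} s * levy_density 1 s) \<partial>lborel)"
    using t s0 levy_density_le[of t s0]
    by (intro nn_integral_mono) (auto split: split_indicator simp: ennreal_mult'[symmetric] intro!: ennreal_leI)
  also have "\<dots> = ennreal (t * exp (1 / kappa s0)) * emeasure (poisson_clock 1) UNIV"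
    unfolding poisson_clock_def by (subst nn_integral_cmult) (auto simp: emeasure_density)
  finally show ?thesis by (simp add: poisson_clock_total)
qed


section \<open>The Mehler kernel as a Gaussian bump\<close>

lemma powr_le_exp:
  fixes z k :: real
  assumes "0 \<le> z" "0 < k"
  shows "z powr k \<le> k powr k * exp z"
proof -
  have "z / k \<le> exp (z / k)"
    using exp_ge_add_one_self[of "z / k"] by linarith
  then have "(z / k) powr k \<le> exp (z / k) powr k"
    using assms by (intro powr_mono2) auto
  also have "exp (z / k) powr k = exp z"
    using assms by (simp add: powr_def)
  finally show ?thesis
    using assms by (simp add: powr_divide divide_le_eq mult.commute)
qed

text \<open>
  The kernel of \<open>exp (- \<tau> * L)\<close> at \<open>s = tanh \<tau>\<close>.
\<close>

definition mehler_kernel :: "real \<Rightarrow> 'a::euclidean_space \<Rightarrow> 'a \<Rightarrow> real" where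
  "mehler_kernel s x y = ((1 - s\<^sup>2) / (4 * pi * s)) powr (real DIM('a) / 2)
     * exp (- (1/4) * ((norm (x - y))\<^sup>2 / s + s * (norm (x + y))\<^sup>2))"

text \<open>
  This and the next two definitions are the height, the rate of decay and the centre of the Gaussian bump that \<open>mehler_kernel s x\<close> is in its second
  argument.  The centre lies at \<open>mehler_contraction s *\<^sub>R x\<close>, hence never farther from 0 than \<open>x\<close>.
\<close>

definition mehler_peak :: "real \<Rightarrow> 'a::euclidean_space \<Rightarrow> real" where
  "mehler_peak s x = ((1 - s\<^sup>2) / (4 * pi * s)) powr (real DIM('a) / 2)
     * exp (- (s * (norm x)\<^sup>2 / (1 + s\<^sup>2)))"

definition mehler_rate :: "real \<Rightarrow> real" where
  "mehler_rate s = (1 + s\<^sup>2) / (4 * s)"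

definition mehler_contraction :: "real \<Rightarrow> real" where
  "mehler_contraction s = (1 - s\<^sup>2) / (1 + s\<^sup>2)"

lemma mehler_rate_pos: "0 < s \<Longrightarrow> 0 < mehler_rate s"
  unfolding mehler_rate_def by (intro divide_pos_pos add_pos_nonneg) auto

lemma mehler_contraction_bounds:
  assumes "0 < s" "s < 1"
  shows "0 < mehler_contraction s" "mehler_contraction s < 1"
proof -
  have "0 < s\<^sup>2" "s\<^sup>2 < 1" "0 < 1 + s\<^sup>2"
    using assms by (simp_all add: power_less_one_iff add_pos_pos)
  then show "0 < mehler_contraction s" "mehler_contraction s < 1"
    unfolding mehler_contraction_def by (simp_all add: divide_less_eq)
qed

lemma mehler_measurable [measurable]:
  "mehler_rate \<in> borel_measurable borel" "mehler_contraction \<in> borel_measurable borel"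
  "(\<lambda>s. mehler_peak s x) \<in> borel_measurable borel"
  unfolding mehler_rate_def[abs_def] mehler_contraction_def[abs_def] mehler_peak_def
  by measurable

text \<open>
  Complete the square in \<open>y\<close>: the quadratic form in the exponent is
  \<open>(1/s + s) * (|x|\<^sup>2 + |y|\<^sup>2) - 2 * (1/s - s) * (x \<bullet> y)\<close>.
\<close>

lemma mehler_kernel_gaussian:
  fixes x y :: "'a::euclidean_space"
  assumes "0 < s"
  shows "mehler_kernel s x y
    = mehler_peak s x * exp (- (mehler_rate s * (norm (y - mehler_contraction s *\<^sub>R x))\<^sup>2))"
proof -
  have "0 < 1 + s\<^sup>2" by (intro add_pos_nonneg) auto
  with assms have s: "s \<noteq> 0" "1 + s\<^sup>2 \<noteq> 0" by auto
  have "- (1/4) * ((norm (x - y))\<^sup>2 / s + s * (norm (x + y))\<^sup>2)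
      = - (s * (norm x)\<^sup>2 / (1 + s\<^sup>2))
        + - (mehler_rate s * (norm (y - mehler_contraction s *\<^sub>R x))\<^sup>2)"
  proof -
    define X Y Z where "X = x \<bullet> x" and "Y = y \<bullet> y" and "Z = x \<bullet> y"
    have n: "(norm (x - y))\<^sup>2 = X - 2 * Z + Y" "(norm (x + y))\<^sup>2 = X + 2 * Z + Y" "(norm x)\<^sup>2 = X"
      "(norm (y - mehler_contraction s *\<^sub>R x))\<^sup>2
        = Y - 2 * mehler_contraction s * Z + (mehler_contraction s)\<^sup>2 * X"
      unfolding X_def Y_def Z_def power2_norm_eq_inner
      by (simp_all add: inner_diff inner_add inner_commute power2_eq_square algebra_simps)
    have "4 * s * (1 + s\<^sup>2) * (- (1/4) * ((X - 2 * Z + Y) / s + s * (X + 2 * Z + Y)))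
      = 4 * s * (1 + s\<^sup>2) * (- (s * X / (1 + s\<^sup>2)) + - (mehler_rate s * (Y - 2 * mehler_contraction s * Z + (mehler_contraction s)\<^sup>2 * X)))"
    proof -
      define c where "c = mehler_contraction s"
      have c: "(1 + s\<^sup>2) * c = 1 - s\<^sup>2" using s by (simp add: c_def mehler_contraction_def)
      have "4 * s * (1 + s\<^sup>2) * (- (s * X / (1 + s\<^sup>2)) + - (mehler_rate s * (Y - 2 * c * Z + c\<^sup>2 * X)))
        = - 4 * s\<^sup>2 * X - ((1 + s\<^sup>2)\<^sup>2 * Y - 2 * (1 + s\<^sup>2) * ((1 + s\<^sup>2) * c) * Z + ((1 + s\<^sup>2) * c)\<^sup>2 * X)"
        using s unfolding mehler_rate_def by (simp add: divide_simps) (simp add: power2_eq_square algebra_simps)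
      also have "\<dots> = - (1 + s\<^sup>2) * ((X - 2 * Z + Y) + s\<^sup>2 * (X + 2 * Z + Y))"
        unfolding c by (simp add: power2_eq_square algebra_simps)
      also have "\<dots> = 4 * s * (1 + s\<^sup>2) * (- (1/4) * ((X - 2 * Z + Y) / s + s * (X + 2 * Z + Y)))"
        using s by (simp add: divide_simps) (simp add: power2_eq_square algebra_simps)
      finally show ?thesis by (simp add: c_def)
    qed
    then show ?thesis
      unfolding n using s by (subst (asm) mult_cancel_left) simp
  qed
  then show ?thesis
    unfolding mehler_kernel_def mehler_peak_def by (simp add: exp_add[symmetric] mult.assoc)
qed

lemma mehler_peak_nonneg: "0 \<le> mehler_peak s x"
  by (simp add: mehler_peak_def)

lemma mehler_kernel_nonneg: "0 \<le> mehler_kernel s x y"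
  by (simp add: mehler_kernel_def)

lemma mehler_peak_le_0:
  fixes x :: "'a::euclidean_space"
  assumes "0 < s"
  shows "mehler_peak s x \<le> mehler_peak s (0::'a)"
proof -
  have "0 < 1 + s\<^sup>2" by (intro add_pos_nonneg) auto
  then show ?thesis
    using assms unfolding mehler_peak_def by (intro mult_left_mono) auto
qed

lemma mehler_kernel_le_peak:
  assumes "0 < s"
  shows "mehler_kernel s x y \<le> mehler_peak s x"
  unfolding mehler_kernel_gaussian[OF assms]
  using mehler_rate_pos[OF assms] mehler_peak_nonneg[of s x] by (intro mult_left_le) auto

lemma kappa_le: 
  assumes "0 < s" "s < 1"
  shows "kappa s \<le> 4 * s / (1 - s)"
proof -
  have "(1 + s) / (1 - s) = 1 + 2 * s / (1 - s)" using assms by (simp add: field_simps)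
  then show ?thesis
    unfolding kappa_def using ln_add_one_self_le_self[of "2 * s / (1 - s)"] assms by simp
qed

text \<open>
  The Poisson-Hermite kernel at the origin is of order \<open>1 / t ^ d\<close>, as for the classical Poisson kernel.
  Since \<open>(1 - s\<^sup>2) / s \<le> 8 / kappa s\<close>, the peak is at most a multiple of \<open>kappa s powr (- d/2)\<close>, and half
  of the exponent \<open>t\<^sup>2 / kappa s\<close> absorbs this power at the cost of \<open>t powr (- d)\<close>; what remains is
  the Levy density for the time \<open>t / sqrt 2\<close>.
\<close>

lemma poisson_clock_mehler_peak:
  "\<exists>C\<ge>0. \<forall>t>0. (\<integral>\<^sup>+ s. ennreal (mehler_peak s (0::'a::euclidean_space)) \<partial>poisson_clock t)
     \<le> ennreal (C / t ^ DIM('a))"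
proof -
  define h where "h = real DIM('a) / 2"
  have h: "0 < h" by (simp add: h_def)
  define C where "C = (4 / pi) powr h * h powr h * sqrt 2"
  have "(\<integral>\<^sup>+ s. ennreal (mehler_peak s (0::'a)) \<partial>poisson_clock t) \<le> ennreal (C / t ^ DIM('a))"
    if t: "0 < t" for t
  proof -
    have bound: "levy_density t s * mehler_peak s (0::'a) \<le> C / t ^ DIM('a) * levy_density (t / sqrt 2) s"
      if s: "0 < s" "s < 1" for s
    proof -
      define k where "k = kappa s"
      have k: "0 < k" unfolding k_def using s by (rule kappa_pos)
      have s2: "0 < 1 - s\<^sup>2" using s by (simp add: power_less_one_iff)
      have "(1 - s\<^sup>2) / (4 * pi * s) \<le> 2 / (pi * k)"
      proof -
        have "k * (1 - s\<^sup>2) \<le> 4 * s / (1 - s) * (1 - s\<^sup>2)"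
          unfolding k_def using s s2 by (intro mult_right_mono kappa_le) auto
        also have "\<dots> = 4 * s * (1 + s)"
          using s by (simp add: divide_simps) (simp add: power2_eq_square algebra_simps)
        also have "\<dots> \<le> 8 * s" using s by simp
        finally show ?thesis using s k by (simp add: divide_simps mult_ac)
      qed
      then have "mehler_peak s (0::'a) \<le> (2 / (pi * k)) powr h"
        using s s2 unfolding mehler_peak_def h_def by (auto intro!: powr_mono2)
      also have "2 / (pi * k) = (4 / pi) * ((t\<^sup>2 / (2 * k)) * (1 / t\<^sup>2))"
        using t k by (simp add: field_simps)
      also have "\<dots> powr h = (4 / pi) powr h * ((t\<^sup>2 / (2 * k)) powr h * (1 / t\<^sup>2) powr h)"
        using t k powr_mult[of "4 / pi" "(t\<^sup>2 / (2 * k)) * (1 / t\<^sup>2)" h] powr_mult[of "t\<^sup>2 / (2 * k)" "1 / t\<^sup>2" h] by (simp del: times_divide_eq_left times_divide_eq_right)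
      also have "(1 / t\<^sup>2) powr h = 1 / t ^ DIM('a)"
      proof -
        have "t\<^sup>2 powr h = (t powr 2) powr h" using t by simp
        also have "\<dots> = t powr real DIM('a)" by (simp only: powr_powr) (simp add: h_def)
        finally show ?thesis using t by (simp add: powr_divide powr_realpow)
      qed
      also have "(4 / pi) powr h * ((t\<^sup>2 / (2 * k)) powr h * (1 / t ^ DIM('a)))
          \<le> (4 / pi) powr h * ((h powr h * exp (t\<^sup>2 / (2 * k))) * (1 / t ^ DIM('a)))"
        using t k h by (intro mult_left_mono mult_right_mono powr_le_exp) auto
      finally have "mehler_peak s (0::'a)
          \<le> (4 / pi) powr h * h powr h / t ^ DIM('a) * exp (t\<^sup>2 / (2 * k))" by simp
      then have "levy_density t s * mehler_peak s (0::'a)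
          \<le> levy_density t s * ((4 / pi) powr h * h powr h / t ^ DIM('a) * exp (t\<^sup>2 / (2 * k)))"
        using s t by (intro mult_left_mono levy_density_nonneg) auto
      also have "\<dots> = C / t ^ DIM('a) * levy_density (t / sqrt 2) s"
      proof -
        have "exp (- t\<^sup>2 / k) * exp (t\<^sup>2 / (2 * k)) = exp (- (t / sqrt 2)\<^sup>2 / k)"
          using k by (simp add: exp_add[symmetric] power_divide field_simps)
        then have "levy_density t s * exp (t\<^sup>2 / (2 * k)) = sqrt 2 * levy_density (t / sqrt 2) s"
          unfolding levy_density_def k_def[symmetric] by (simp add: mult_ac)
        then show ?thesis
          unfolding C_def mult.left_commute[of "levy_density t s"] by simp
      qed
      finally show ?thesis .
    qed
    have "(\<integral>\<^sup>+ s. ennreal (mehler_peak s (0::'a)) \<partial>poisson_clock t)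
        = (\<integral>\<^sup>+ s. ennreal (indicator {0<..<1} s * levy_density t s) * ennreal (mehler_peak s (0::'a)) \<partial>lborel)"
      by (rule nn_integral_poisson_clock) measurable
    also have "\<dots> \<le> (\<integral>\<^sup>+ s. ennreal (C / t ^ DIM('a)) * ennreal (indicator {0<..<1} s * levy_density (t / sqrt 2) s) \<partial>lborel)"
      using bound t by (intro nn_integral_mono)
        (auto split: split_indicator simp: ennreal_mult'[symmetric] ennreal_mult''[symmetric] mehler_peak_nonneg levy_density_nonneg C_def intro!: ennreal_leI)
    also have "\<dots> = ennreal (C / t ^ DIM('a)) * emeasure (poisson_clock (t / sqrt 2)) UNIV"
      unfolding poisson_clock_def by (subst nn_integral_cmult) (auto simp: emeasure_density)
    finally show ?thesis using t by (simp add: poisson_clock_total)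
  qed
  moreover have "0 \<le> C" by (simp add: C_def)
  ultimately show ?thesis by blast
qed


section \<open>Superposition of balls\<close>

text \<open>
  The exponential distribution enters through \<open>exp (- u) = P (u < v)\<close>, which writes a Gaussian
  \<open>exp (- b * |y - z|\<^sup>2)\<close> as an average of indicators of the balls with centre \<open>z\<close> and random radius
  \<open>sqrt (v / b)\<close>.
\<close>

definition unit_exponential :: "real measure" where
  "unit_exponential = density lborel (\<lambda>v. ennreal (indicator {0..} v * exp (- v)))"

lemma sets_unit_exponential [measurable_cong, simp]: "sets unit_exponential = sets borel"
  by (simp add: unit_exponential_def)

lemma space_unit_exponential [simp]: "space unit_exponential = UNIV"
  by (simp add: unit_exponential_def)

lemma nn_integral_unit_exponential:
  assumes "f \<in> borel_measurable borel"
  shows "(\<integral>\<^sup>+ v. f v \<partial>unit_exponential)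
    = (\<integral>\<^sup>+ v. ennreal (indicator {0..} v * exp (- v)) * f v \<partial>lborel)"
  using assms unfolding unit_exponential_def by (subst nn_integral_density) auto

lemma AE_unit_exponential: "AE v in unit_exponential. 0 \<le> v"
  unfolding unit_exponential_def by (subst AE_density) (auto intro!: AE_I2 split: split_indicator_asm)

lemma unit_exponential_tail:
  assumes "0 \<le> u"
  shows "emeasure unit_exponential {u<..} = ennreal (exp (- u))"
proof -
  have "emeasure unit_exponential {u<..}
      = (\<integral>\<^sup>+ v. ennreal (indicator {0..} v * exp (- v)) * indicator {u<..} v \<partial>lborel)"
    unfolding unit_exponential_def by (rule emeasure_density) auto
  also have "\<dots> = (\<integral>\<^sup>+ v. ennreal (exp (- v)) * indicator {u..} v \<partial>lborel)"
    using assms AE_lborel_singleton[of u]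
    by (intro nn_integral_cong_AE) (auto split: split_indicator elim!: eventually_mono)
  also have "\<dots> = ennreal (0 - - exp (- u))"
  proof (rule nn_integral_FTC_atLeast)
    show "((\<lambda>v::real. - exp (- v)) \<longlongrightarrow> 0) at_top"
      using tendsto_minus[OF filterlim_compose[OF exp_at_bot filterlim_uminus_at_bot_at_top]] by simp
  qed (auto intro!: derivative_eq_intros)
  finally show ?thesis by simp
qed

lemma finite_measure_clock: "0 < t \<Longrightarrow> finite_measure (poisson_clock t)"
  by (rule finite_measureI) (simp add: poisson_clock_total)

lemma unit_exponential_total: "emeasure unit_exponential UNIV = 1"
proof -
  have "AE v in unit_exponential. 0 < v"
    unfolding unit_exponential_def using AE_lborel_singleton[of "0::real"]
    by (subst AE_density) (auto split: split_indicator_asm elim!: eventually_mono)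
  then have "emeasure unit_exponential UNIV = emeasure unit_exponential {0<..}"
    by (intro emeasure_eq_AE) auto
  then show ?thesis by (simp add: unit_exponential_tail)
qed

lemma finite_measure_unit_exponential: "finite_measure unit_exponential"
  by (rule finite_measureI) (simp add: unit_exponential_total)

lemma unit_exponential_moment:
  assumes "0 \<le> h"
  shows "(\<integral>\<^sup>+ v. ennreal (v powr h) \<partial>unit_exponential) = ennreal (Gamma (h + 1))"
proof -
  have "((\<lambda>v. v powr ((h + 1) - 1) / exp v) has_integral Gamma (h + 1)) {0..}"
    using assms by (intro Gamma_integral_real) simp
  then have "(\<integral>\<^sup>+ v. indicator {0..} v * (v powr ((h + 1) - 1) / exp v) \<partial>lborel) = ennreal (Gamma (h + 1))"
    by (intro nn_integral_has_integral_lebesgue) auto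
  then show ?thesis
    by (subst nn_integral_unit_exponential)
      (auto simp: ennreal_mult''[symmetric] exp_minus divide_inverse mult_ac cong: nn_integral_cong)
qed

lemma mem_ball_sqrt_iff:
  fixes y z :: "'a::euclidean_space"
  assumes "0 < b"
  shows "y \<in> ball z (sqrt (v / b)) \<longleftrightarrow> b * (norm (y - z))\<^sup>2 < v"
proof -
  have "y \<in> ball z (sqrt (v / b)) \<longleftrightarrow> sqrt ((norm (y - z))\<^sup>2) < sqrt (v / b)"
    by (simp add: dist_norm norm_minus_commute)
  also have "\<dots> \<longleftrightarrow> b * (norm (y - z))\<^sup>2 < v"
    using assms by (simp only: real_sqrt_less_iff) (simp add: field_simps)
  finally show ?thesis .
qed

lemma gaussian_layer_cake:
  fixes m :: "'a::euclidean_space measure"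
  assumes b: "0 < b" and m: "sigma_finite_measure m" and [simp, measurable_cong]: "sets m = sets borel"
  shows "(\<integral>\<^sup>+ y. ennreal (exp (- (b * (norm (y - z))\<^sup>2))) \<partial>m)
    = (\<integral>\<^sup>+ v. emeasure m (ball z (sqrt (v / b))) \<partial>unit_exponential)"
proof -
  interpret m: sigma_finite_measure m by fact
  interpret e: finite_measure unit_exponential by (rule finite_measure_unit_exponential)
  interpret me: pair_sigma_finite m unit_exponential by standard
  let ?B = "\<lambda>v. ball z (sqrt (v / b))"
  have "(\<integral>\<^sup>+ v. indicator (?B v) y \<partial>unit_exponential) = ennreal (exp (- (b * (norm (y - z))\<^sup>2)))" for y
  proof -
    have "indicator (?B v) y = (indicator {b * (norm (y - z))\<^sup>2<..} v :: ennreal)" for v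
      unfolding indicator_def by (simp del: mem_ball add: mem_ball_sqrt_iff[OF b])
    then have "(\<integral>\<^sup>+ v. indicator (?B v) y \<partial>unit_exponential)
        = emeasure unit_exponential {b * (norm (y - z))\<^sup>2<..}" by simp
    then show ?thesis
      using b by (simp add: unit_exponential_tail)
  qed
  then have "(\<integral>\<^sup>+ y. ennreal (exp (- (b * (norm (y - z))\<^sup>2))) \<partial>m)
      = (\<integral>\<^sup>+ y. (\<integral>\<^sup>+ v. indicator (?B v) y \<partial>unit_exponential) \<partial>m)"
    by simp
  also have "\<dots> = (\<integral>\<^sup>+ v. (\<integral>\<^sup>+ y. indicator (?B v) y \<partial>m) \<partial>unit_exponential)"
    by (rule me.Fubini'[symmetric]) (unfold indicator_def mem_ball, measurable)
  also have "\<dots> = (\<integral>\<^sup>+ v. emeasure m (?B v) \<partial>unit_exponential)"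
    by simp
  finally show ?thesis .
qed

text \<open>
  The average of \<open>\<phi> centre radius\<close> over the random balls of which \<open>poisson_density t x\<close> is the
  superposition.  Applied to \<open>\<phi> z r = emeasure m (ball z r)\<close> it integrates the kernel against \<open>m\<close>.
\<close>

definition ball_average :: "real \<Rightarrow> 'a::euclidean_space \<Rightarrow> ('a \<Rightarrow> real \<Rightarrow> ennreal) \<Rightarrow> ennreal" where
  "ball_average t x \<phi> = (\<integral>\<^sup>+ s. ennreal (mehler_peak s x) *
     (\<integral>\<^sup>+ v. \<phi> (mehler_contraction s *\<^sub>R x) (sqrt (v / mehler_rate s)) \<partial>unit_exponential) \<partial>poisson_clock t)"

definition poisson_density :: "real \<Rightarrow> 'a::euclidean_space \<Rightarrow> 'a \<Rightarrow> ennreal" where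
  "poisson_density t x y = (\<integral>\<^sup>+ s. ennreal (mehler_kernel s x y) \<partial>poisson_clock t)"

lemma poisson_density_measurable:
  assumes "0 < t"
  shows "poisson_density t x \<in> borel_measurable borel"
proof -
  interpret finite_measure "poisson_clock t" using assms by (rule finite_measure_clock)
  show ?thesis unfolding poisson_density_def
    by (rule borel_measurable_nn_integral) (unfold mehler_kernel_def, measurable)
qed

text \<open>
  The centres occurring in the average satisfy \<open>norm z \<le> norm x\<close>, so that pointwise bounds are only
  needed for these.
\<close>

lemma ball_average_mono:
  assumes "\<And>z r. norm z \<le> norm x \<Longrightarrow> 0 \<le> r \<Longrightarrow> \<phi> z r \<le> \<psi> z r"
  shows "ball_average t x \<phi> \<le> ball_average t x \<psi>"
  unfolding ball_average_def
proof (rule nn_integral_mono_AE, rule eventually_mono[OF AE_poisson_clock], rule mult_left_mono)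
  fix s :: real assume s: "0 < s \<and> s < 1"
  show "(\<integral>\<^sup>+ v. \<phi> (mehler_contraction s *\<^sub>R x) (sqrt (v / mehler_rate s)) \<partial>unit_exponential)
      \<le> (\<integral>\<^sup>+ v. \<psi> (mehler_contraction s *\<^sub>R x) (sqrt (v / mehler_rate s)) \<partial>unit_exponential)"
  proof (rule nn_integral_mono_AE, rule eventually_mono[OF AE_unit_exponential], rule assms)
    show "norm (mehler_contraction s *\<^sub>R x) \<le> norm x"
      using mehler_contraction_bounds[of s] s by (simp add: mult_left_le_one_le)
  qed (use mehler_rate_pos[of s] s in simp)
qed simp

lemma ball_average_linear:
  fixes \<phi> :: "'a::euclidean_space \<Rightarrow> real \<Rightarrow> ennreal"
  assumes [measurable]: "(\<lambda>(z, r). \<phi> z r) \<in> borel_measurable (borel \<Otimes>\<^sub>M borel)"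
    "(\<lambda>(z, r). \<psi> z r) \<in> borel_measurable (borel \<Otimes>\<^sub>M borel)"
  shows "ball_average t x (\<lambda>z r. \<phi> z r + a * \<psi> z r) = ball_average t x \<phi> + a * ball_average t x \<psi>"
proof -
  interpret finite_measure unit_exponential by (rule finite_measure_unit_exponential)
  have [measurable]: "(\<lambda>s. \<integral>\<^sup>+ v. \<eta> (mehler_contraction s *\<^sub>R x) (sqrt (v / mehler_rate s)) \<partial>unit_exponential)
      \<in> borel_measurable borel"
    if [measurable]: "(\<lambda>(z, r). \<eta> z r) \<in> borel_measurable (borel \<Otimes>\<^sub>M borel)" for \<eta> :: "'a \<Rightarrow> real \<Rightarrow> ennreal"
    by measurable
  show ?thesis
    unfolding ball_average_def
    by (simp add: nn_integral_add nn_integral_cmult distrib_left mult.left_commute[of _ a])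
qed

lemma measurable_emeasure_ball:
  fixes m :: "'a::euclidean_space measure"
  assumes "sigma_finite_measure m" and [simp, measurable_cong]: "sets m = sets borel"
  shows "(\<lambda>(z, r). emeasure m (ball z r)) \<in> borel_measurable (borel \<Otimes>\<^sub>M borel)"
proof -
  interpret sigma_finite_measure m by fact
  have sp: "space m = UNIV" using sets_eq_imp_space_eq[of m borel] by simp
  have [simp]: "sets ((borel \<Otimes>\<^sub>M borel) \<Otimes>\<^sub>M m) = sets (((borel :: 'a measure) \<Otimes>\<^sub>M (borel :: real measure)) \<Otimes>\<^sub>M borel)"
    by (intro sets_pair_measure_cong) auto
  have "(\<lambda>p. emeasure m (ball (fst p) (snd p))) \<in> borel_measurable ((borel :: 'a measure) \<Otimes>\<^sub>M (borel :: real measure))"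
  proof (rule measurable_emeasure)
    show "{q \<in> space ((borel \<Otimes>\<^sub>M borel) \<Otimes>\<^sub>M m). snd q \<in> ball (fst (fst q)) (snd (fst q))} \<in> sets (((borel :: 'a measure) \<Otimes>\<^sub>M (borel :: real measure)) \<Otimes>\<^sub>M m)"
      unfolding mem_ball by measurable
  qed (simp add: sp)
  then show ?thesis by (simp add: case_prod_beta)
qed

lemma nn_integral_poisson_density:
  fixes m :: "'a::euclidean_space measure"
  assumes t: "0 < t" and m: "sigma_finite_measure m" and [simp, measurable_cong]: "sets m = sets borel"
  shows "(\<integral>\<^sup>+ y. poisson_density t x y \<partial>m) = ball_average t x (\<lambda>z r. emeasure m (ball z r))"
proof -
  interpret m: sigma_finite_measure m by fact
  interpret c: finite_measure "poisson_clock t" using t by (rule finite_measure_clock)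
  interpret mc: pair_sigma_finite m "poisson_clock t" by standard
  have "(\<integral>\<^sup>+ y. poisson_density t x y \<partial>m) = (\<integral>\<^sup>+ s. (\<integral>\<^sup>+ y. ennreal (mehler_kernel s x y) \<partial>m) \<partial>poisson_clock t)"
    unfolding poisson_density_def by (rule mc.Fubini'[symmetric]) (unfold mehler_kernel_def, measurable)
  also have "\<dots> = ball_average t x (\<lambda>z r. emeasure m (ball z r))"
    unfolding ball_average_def
  proof (rule nn_integral_cong_AE, rule eventually_mono[OF AE_poisson_clock])
    fix s :: real assume s: "0 < s \<and> s < 1"
    have "(\<integral>\<^sup>+ y. ennreal (mehler_kernel s x y) \<partial>m)
        = (\<integral>\<^sup>+ y. ennreal (mehler_peak s x) * ennreal (exp (- (mehler_rate s * (norm (y - mehler_contraction s *\<^sub>R x))\<^sup>2))) \<partial>m)"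
      using s by (simp add: mehler_kernel_gaussian ennreal_mult mehler_peak_nonneg)
    also have "\<dots> = ennreal (mehler_peak s x)
        * (\<integral>\<^sup>+ y. ennreal (exp (- (mehler_rate s * (norm (y - mehler_contraction s *\<^sub>R x))\<^sup>2))) \<partial>m)"
      by (rule nn_integral_cmult) measurable
    finally show "(\<integral>\<^sup>+ y. ennreal (mehler_kernel s x y) \<partial>m) = ennreal (mehler_peak s x)
        * (\<integral>\<^sup>+ v. emeasure m (ball (mehler_contraction s *\<^sub>R x) (sqrt (v / mehler_rate s))) \<partial>unit_exponential)"
      using s by (simp add: gaussian_layer_cake m mehler_rate_pos)
  qed
  finally show ?thesis .
qed


section \<open>Averages of volumes, radii and constants\<close>

text \<open>
  The integral of \<open>mehler_kernel s x\<close> over the whole space.  It is below 1, because \<open>L\<close> has a positive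
  potential, and tends to 1 as \<open>s\<close> tends to 0.
\<close>

definition mehler_mass :: "real \<Rightarrow> 'a::euclidean_space \<Rightarrow> real" where
  "mehler_mass s x = mehler_contraction s powr (real DIM('a) / 2) * exp (- (s * (norm x)\<^sup>2 / (1 + s\<^sup>2)))"

lemma mehler_mass_le_1:
  assumes "0 < s" "s < 1"
  shows "mehler_mass s x \<le> 1"
proof -
  have "0 < 1 + s\<^sup>2" by (intro add_pos_nonneg) auto
  then show ?thesis
    unfolding mehler_mass_def using assms mehler_contraction_bounds[OF assms]
    by (intro mult_le_one powr_le1) auto
qed

lemma exponential_ball_volume:
  fixes z :: "'a::euclidean_space"
  assumes b: "0 < b"
  shows "(\<integral>\<^sup>+ v. emeasure lborel (ball z (sqrt (v / b))) \<partial>unit_exponential)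
    = ennreal ((pi / b) powr (real DIM('a) / 2))"
proof -
  define h where "h = real DIM('a) / 2"
  have h: "0 < h" by (simp add: h_def)
  have G: "0 < Gamma (h + 1)" using h by (simp add: Gamma_real_pos)
  have "(\<integral>\<^sup>+ v. emeasure lborel (ball z (sqrt (v / b))) \<partial>unit_exponential)
      = (\<integral>\<^sup>+ v. ennreal (pi powr h / Gamma (h + 1) / b powr h) * ennreal (v powr h) \<partial>unit_exponential)"
  proof (rule nn_integral_cong_AE, rule eventually_mono[OF AE_unit_exponential])
    fix v :: real assume v: "0 \<le> v"
    have "sqrt (v / b) ^ DIM('a) = (v / b) powr h"
    proof (cases "v = 0")
      case False
      then have "sqrt (v / b) ^ DIM('a) = sqrt (v / b) powr real DIM('a)"
        using v b by (intro powr_realpow[symmetric]) auto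
      also have "\<dots> = ((v / b) powr (1/2)) powr real DIM('a)"
        using v b by (simp add: powr_half_sqrt)
      finally show ?thesis by (simp add: powr_powr h_def)
    qed simp
    then show "emeasure lborel (ball z (sqrt (v / b)))
        = ennreal (pi powr h / Gamma (h + 1) / b powr h) * ennreal (v powr h)"
      using v b G by (simp add: emeasure_ball unit_ball_vol_def h_def[symmetric] ennreal_mult''[symmetric] powr_divide)
  qed
  also have "\<dots> = ennreal (pi powr h / Gamma (h + 1) / b powr h) * ennreal (Gamma (h + 1))"
    using h by (subst nn_integral_cmult) (auto simp: unit_exponential_moment)
  also have "\<dots> = ennreal ((pi / b) powr h)"
    using G b by (simp add: ennreal_mult''[symmetric] powr_divide)
  finally show ?thesis unfolding h_def .
qed

lemma mehler_mass_eq: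
  fixes x z :: "'a::euclidean_space"
  assumes s: "0 < s" "s < 1"
  shows "ennreal (mehler_peak s x) * (\<integral>\<^sup>+ v. emeasure lborel (ball z (sqrt (v / mehler_rate s))) \<partial>unit_exponential)
    = ennreal (mehler_mass s x)"
proof -
  define h where "h = real DIM('a) / 2"
  have "(1 - s\<^sup>2) / (4 * pi * s) * (pi / mehler_rate s) = mehler_contraction s"
    using s unfolding mehler_rate_def mehler_contraction_def by simp
  then have "mehler_contraction s powr h = ((1 - s\<^sup>2) / (4 * pi * s)) powr h * (pi / mehler_rate s) powr h"
    by (metis powr_mult)
  then have "mehler_mass s x = mehler_peak s x * (pi / mehler_rate s) powr h"
    unfolding mehler_peak_def mehler_mass_def h_def[symmetric] by (simp only: mult_ac)
  then show ?thesis
    unfolding exponential_ball_volume[OF mehler_rate_pos[OF s(1)]] h_def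
    by (simp add: ennreal_mult'')
qed

lemma ball_average_lebesgue:
  fixes x :: "'a::euclidean_space"
  shows "ball_average t x (\<lambda>z r. emeasure lborel (ball z r)) = (\<integral>\<^sup>+ s. ennreal (mehler_mass s x) \<partial>poisson_clock t)"
  unfolding ball_average_def
  by (rule nn_integral_cong_AE, rule eventually_mono[OF AE_poisson_clock], rule mehler_mass_eq) auto

lemma ball_average_lebesgue_le_1:
  fixes x :: "'a::euclidean_space"
  assumes "0 < t"
  shows "ball_average t x (\<lambda>z r. emeasure lborel (ball z r)) \<le> 1"
proof -
  have "(\<integral>\<^sup>+ s. ennreal (mehler_mass s x) \<partial>poisson_clock t) \<le> (\<integral>\<^sup>+ s. 1 \<partial>poisson_clock t)"
    by (rule nn_integral_mono_AE, rule eventually_mono[OF AE_poisson_clock])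
      (auto simp: mehler_mass_le_1)
  then show ?thesis
    using assms by (simp add: ball_average_lebesgue poisson_clock_total)
qed

text \<open>
  Up to the volume of the unit ball, \<open>r ^ d\<close> is the Lebesgue measure of a ball of radius \<open>r\<close>, so this
  average is the total integral of the kernel.
\<close>

lemma ball_average_radius_power:
  fixes x :: "'a::euclidean_space"
  assumes "0 < t"
  shows "ball_average t x (\<lambda>z r. ennreal (r ^ DIM('a))) \<le> ennreal (1 / unit_ball_vol DIM('a))"
proof -
  let ?\<omega> = "unit_ball_vol (real DIM('a))"
  have "ball_average t x (\<lambda>z r. ennreal (r ^ DIM('a)))
      \<le> ball_average t x (\<lambda>z r. 0 + ennreal (1 / ?\<omega>) * emeasure lborel (ball z r))"
    by (rule ball_average_mono)
      (simp add: emeasure_ball ennreal_mult''[symmetric] order_less_imp_not_eq2)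
  also have "\<dots> = ball_average t x (\<lambda>z r. 0) + ennreal (1 / ?\<omega>) * ball_average t x (\<lambda>z r. emeasure lborel (ball z r))"
    by (rule ball_average_linear) (simp_all add: measurable_emeasure_ball lborel.sigma_finite_measure_axioms)
  also have "\<dots> \<le> 0 + ennreal (1 / ?\<omega>) * 1"
    by (intro add_mono mult_left_mono ball_average_lebesgue_le_1 assms) (auto simp: ball_average_def)
  finally show ?thesis by simp
qed

lemma ball_average_const_le:
  "\<exists>C\<ge>0. \<forall>t>0. \<forall>x::'a::euclidean_space. ball_average t x (\<lambda>z r. 1) \<le> ennreal (C / t ^ DIM('a))"
proof -
  obtain C where C: "0 \<le> C" "\<And>t. 0 < t \<Longrightarrow>
      (\<integral>\<^sup>+ s. ennreal (mehler_peak s (0::'a)) \<partial>poisson_clock t) \<le> ennreal (C / t ^ DIM('a))"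
    using poisson_clock_mehler_peak by blast
  have "ball_average t x (\<lambda>z r. 1) \<le> ennreal (C / t ^ DIM('a))" if "0 < t" for t and x :: 'a
  proof -
    have "ball_average t x (\<lambda>z r. 1) \<le> (\<integral>\<^sup>+ s. ennreal (mehler_peak s (0::'a)) \<partial>poisson_clock t)"
      unfolding ball_average_def
      by (rule nn_integral_mono_AE, rule eventually_mono[OF AE_poisson_clock])
        (auto simp: unit_exponential_total intro!: ennreal_leI mehler_peak_le_0)
    with C(2)[OF that] show ?thesis by (rule order_trans[rotated])
  qed
  with C(1) show ?thesis by blast
qed

text \<open>
  This bound is where the nontangential region is used.  In \<open>(norm z + r) ^ d\<close> the radius contributes a
  bounded amount for every \<open>x\<close>, while the centre contributes at most \<open>norm x ^ d\<close> times the order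
  \<open>1 / t ^ d\<close> of the kernel at the origin, which is bounded as \<open>norm x < \<alpha> * t\<close>.
\<close>

lemma ball_average_growth:
  assumes \<alpha>: "0 < \<alpha>"
  shows "\<exists>C\<ge>0. \<forall>t>0. \<forall>x::'a::euclidean_space. norm x < \<alpha> * t \<longrightarrow>
    ball_average t x (\<lambda>z r. ennreal ((norm z + r) ^ DIM('a))) \<le> ennreal C"
proof -
  define n where "n = DIM('a)"
  obtain C where C: "0 \<le> C" "\<And>t (x::'a). 0 < t \<Longrightarrow> ball_average t x (\<lambda>z r. 1) \<le> ennreal (C / t ^ n)"
    using ball_average_const_le unfolding n_def by blast
  define \<omega> where "\<omega> = unit_ball_vol (real n)"
  have \<omega>: "0 < \<omega>" by (simp add: \<omega>_def)
  have bound: "ball_average t x (\<lambda>z r. ennreal ((norm z + r) ^ n)) \<le> ennreal (2 ^ n * (\<alpha> ^ n * C) + 2 ^ n * (1 / \<omega>))"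
    if t: "0 < t" and x: "norm x < \<alpha> * t" for t and x :: 'a
  proof -
    have "ball_average t x (\<lambda>z r. ennreal ((norm z + r) ^ n))
        \<le> ball_average t x (\<lambda>z r. ennreal (2 ^ n) * ennreal (r ^ n) + ennreal (2 ^ n * (\<alpha> * t) ^ n) * 1)"
    proof (rule ball_average_mono)
      fix z :: 'a and r :: real assume z: "norm z \<le> norm x" and r: "0 \<le> r"
      have "(norm z + r) ^ n \<le> (2 * max (\<alpha> * t) r) ^ n"
        using z r x by (intro power_mono) auto
      also have "\<dots> \<le> 2 ^ n * r ^ n + 2 ^ n * (\<alpha> * t) ^ n"
        using \<alpha> t r by (auto simp: power_mult_distrib max_def)
      finally show "ennreal ((norm z + r) ^ n) \<le> ennreal (2 ^ n) * ennreal (r ^ n) + ennreal (2 ^ n * (\<alpha> * t) ^ n) * 1"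
        using r \<alpha> t by (simp add: ennreal_mult''[symmetric] ennreal_plus[symmetric] ennreal_leI del: ennreal_plus)
    qed
    also have "\<dots> = ball_average t x (\<lambda>z r. 0 + ennreal (2 ^ n) * ennreal (r ^ n)) + ennreal (2 ^ n * (\<alpha> * t) ^ n) * ball_average t x (\<lambda>z r. 1)"
      by (subst ball_average_linear) (auto simp: case_prod_beta)
    also have "\<dots> = ennreal (2 ^ n) * ball_average t x (\<lambda>z r. ennreal (r ^ n)) + ennreal (2 ^ n * (\<alpha> * t) ^ n) * ball_average t x (\<lambda>z r. 1)"
      by (subst ball_average_linear) (auto simp: case_prod_beta ball_average_def)
    also have "\<dots> \<le> ennreal (2 ^ n) * ennreal (1 / \<omega>) + ennreal (2 ^ n * (\<alpha> * t) ^ n) * ennreal (C / t ^ n)"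
      unfolding \<omega>_def n_def using C(2)[OF t] t
      by (intro add_mono mult_left_mono ball_average_radius_power) (auto simp: n_def)
    also have "\<dots> = ennreal (2 ^ n * (\<alpha> ^ n * C) + 2 ^ n * (1 / \<omega>))"
      using t \<alpha> C(1) \<omega> by (simp add: ennreal_mult''[symmetric] ennreal_plus[symmetric] power_mult_distrib add.commute del: ennreal_plus)
    finally show ?thesis .
  qed
  show ?thesis
    using bound C(1) \<alpha> \<omega> unfolding n_def[symmetric]
    by (intro exI[of _ "2 ^ n * (\<alpha> ^ n * C) + 2 ^ n * (1 / \<omega>)"]) auto
qed

section \<open>The Poisson-Hermite kernel as a subordinated Mehler kernel\<close>

lemma poisson_density_le:
  assumes "0 < t"
  shows "poisson_density t x y \<le> (\<integral>\<^sup>+ s. ennreal (mehler_peak s x) \<partial>poisson_clock t)"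
  unfolding poisson_density_def
  by (rule nn_integral_mono_AE, rule eventually_mono[OF AE_poisson_clock])
    (auto intro!: ennreal_leI mehler_kernel_le_peak)

lemma poisson_density_finite:
  fixes x y :: "'a::euclidean_space"
  assumes "0 < t"
  shows "poisson_density t x y < \<infinity>"
proof -
  obtain C where C: "ball_average t x (\<lambda>z r. 1) \<le> ennreal (C / t ^ DIM('a))"
    using ball_average_const_le[where 'a='a] assms by blast
  have "poisson_density t x y \<le> ball_average t x (\<lambda>z r. 1)"
    using poisson_density_le[OF assms] by (simp add: ball_average_def unit_exponential_total)
  with C show ?thesis
    by (metis ennreal_less_top infinity_ennreal_def order_le_less_trans)
qed

text \<open>
  The Bochner integral that defines the kernel would be 0 if the integrand were not integrable; finiteness of
  \<open>poisson_density\<close> excludes this.  The constant \<open>8 * (4 * pi) powr (- (d + 1) / 2)\<close> splits into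
  \<open>4 / sqrt pi\<close> for the Levy density and \<open>(4 * pi) powr (- d / 2)\<close> for the Mehler kernel.
\<close>

lemma poisson_hermite_kernel_eq:
  fixes x y :: "'a::euclidean_space"
  assumes t: "0 < t"
  shows "ennreal (poisson_hermite_kernel t x y) = poisson_density t x y"
    and "0 \<le> poisson_hermite_kernel t x y"
proof -
  define h where "h = real DIM('a) / 2"
  define E where "E s = exp (- (1/4) * ((norm (x - y))\<^sup>2 / s + s * (norm (x + y))\<^sup>2))" for s
  define f where "f s = exp (- t\<^sup>2 / kappa s) * (1 - s\<^sup>2) powr (h - 1) * E s / (s powr h * kappa s powr (3/2))" for s
  define c where "c = 8 * (4 * pi) powr (- ((real DIM('a) + 1) / 2)) * t"
  have cf: "c * f s = levy_density t s * mehler_kernel s x y" if s: "0 < s" "s < 1" for s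
  proof -
    have k: "0 < kappa s" using s by (rule kappa_pos)
    have s2: "0 < 1 - s\<^sup>2" using s by (simp add: power_less_one_iff)
    have "- ((real DIM('a) + 1) / 2) = - h + - (1/2)"
      by (simp add: h_def field_simps)
    then have "(4 * pi) powr (- ((real DIM('a) + 1) / 2)) = (4 * pi) powr (- h + - (1/2))"
      by (simp only:)
    also have "\<dots> = 1 / ((4 * pi) powr h * (2 * sqrt pi))"
      unfolding powr_add by (simp add: powr_minus powr_half_sqrt real_sqrt_mult divide_simps)
    finally have c: "c = 4 / ((4 * pi) powr h * sqrt pi) * t" by (simp add: c_def)
    have "(1 - s\<^sup>2) powr (h - 1) = (1 - s\<^sup>2) powr h / (1 - s\<^sup>2)"
      using s2 by (simp add: powr_diff)
    moreover have "kappa s powr (- (3/2)) = 1 / kappa s powr (3/2)"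
      by (simp add: powr_minus divide_simps)
    moreover have "((1 - s\<^sup>2) / (4 * pi * s)) powr h = (1 - s\<^sup>2) powr h / ((4 * pi) powr h * s powr h)"
      using s s2 by (subst powr_divide) (auto simp: powr_mult)
    ultimately show ?thesis
      unfolding c f_def levy_density_def mehler_kernel_def E_def[symmetric] h_def[symmetric]
      by (simp add: mult_ac)
  qed
  have "poisson_hermite_kernel t x y = c * (LBINT s:{0<..<1}. f s)"
    by (simp add: poisson_hermite_kernel_def c_def f_def E_def h_def)
  also have "\<dots> = (LBINT s. indicator {0<..<1} s * levy_density t s * mehler_kernel s x y)"
    unfolding set_lebesgue_integral_def integral_mult_right_zero[symmetric]
    by (intro Bochner_Integration.integral_cong) (auto split: split_indicator simp: cf)
  also have "\<dots> = enn2real (\<integral>\<^sup>+ s. ennreal (indicator {0<..<1} s * levy_density t s * mehler_kernel s x y) \<partial>lborel)"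
    using t by (intro integral_eq_nn_integral)
      (auto split: split_indicator simp: levy_density_nonneg mehler_kernel_nonneg mehler_kernel_def intro!: AE_I2)
  also have "(\<integral>\<^sup>+ s. ennreal (indicator {0<..<1} s * levy_density t s * mehler_kernel s x y) \<partial>lborel)
      = poisson_density t x y"
    unfolding poisson_density_def
    by (subst nn_integral_poisson_clock)
      (auto simp: ennreal_mult'' mehler_kernel_nonneg mehler_kernel_def)
  finally have "poisson_hermite_kernel t x y = enn2real (poisson_density t x y)" .
  then show "ennreal (poisson_hermite_kernel t x y) = poisson_density t x y" "0 \<le> poisson_hermite_kernel t x y"
    using poisson_density_finite[OF t, of x y] by auto
qed

lemma poisson_hermite_kernel_measurable:
  assumes t: "0 < t"
  shows "poisson_hermite_kernel t x \<in> borel_measurable borel"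
proof -
  have "(\<lambda>y. enn2real (poisson_density t x y)) \<in> borel_measurable borel"
    using poisson_density_measurable[OF t] by measurable
  then show ?thesis
    using poisson_hermite_kernel_eq[OF t, of x] by (metis (no_types, lifting) enn2real_ennreal ext)
qed


section \<open>Decay of the kernel away from the origin\<close>

text \<open>
  Splitting \<open>1/s + s = 2 + (1 - s)\<^sup>2 / s\<close> isolates the factor \<open>exp (- |y|\<^sup>2 / 2)\<close> of \<^const>\<open>Phi\<close>; what
  remains of the bound depends on \<open>y\<close> through \<open>q = (1 - s) * norm y\<close> alone.
\<close>

lemma mehler_exponent_le:
  fixes x y :: "'a::euclidean_space"
  assumes s: "0 < s" "s < 1"
  defines "q \<equiv> (1 - s) * norm y"
  shows "- (1/4) * ((norm (x - y))\<^sup>2 / s + s * (norm (x + y))\<^sup>2)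
    \<le> - (norm y)\<^sup>2 / 2 - (q\<^sup>2 - 4 * q * norm x) / (4 * s)"
proof -
  define X Y Z where "X = norm x" and "Y = norm y" and "Z = x \<bullet> y"
  have Z: "Z \<le> X * Y" unfolding X_def Y_def Z_def by (rule norm_cauchy_schwarz)
  have XY: "0 \<le> X" "0 \<le> Y" by (simp_all add: X_def Y_def)
  have n: "(norm (x - y))\<^sup>2 = X\<^sup>2 - 2 * Z + Y\<^sup>2" "(norm (x + y))\<^sup>2 = X\<^sup>2 + 2 * Z + Y\<^sup>2"
    unfolding X_def Y_def Z_def power2_norm_eq_inner
    by (simp_all add: inner_diff inner_add inner_commute power2_eq_square algebra_simps)
  have q: "q = (1 - s) * Y" by (simp add: q_def Y_def)
  have "s * s \<le> 1 * 1" using s by (intro mult_mono) auto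
  then have "(1 - s\<^sup>2) * Z \<le> (1 - s\<^sup>2) * (X * Y)"
    using Z by (intro mult_left_mono) (auto simp: power2_eq_square)
  also have "\<dots> \<le> 2 * (1 - s) * (X * Y)"
  proof (rule mult_right_mono)
    have "1 - s\<^sup>2 = (1 + s) * (1 - s)" by (simp add: power2_eq_square algebra_simps)
    also have "\<dots> \<le> 2 * (1 - s)" using s by (intro mult_right_mono) auto
    finally show "1 - s\<^sup>2 \<le> 2 * (1 - s)" .
  qed (use XY in simp)
  finally have Z': "(1 - s\<^sup>2) * Z \<le> 2 * (1 - s) * X * Y" by simp
  have "2 * s * Y\<^sup>2 + (q\<^sup>2 - 4 * q * X) = (1 + s\<^sup>2) * Y\<^sup>2 - 4 * (1 - s) * X * Y"
    unfolding q by (simp add: power2_eq_square algebra_simps)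
  also have "\<dots> \<le> (1 + s\<^sup>2) * (X\<^sup>2 + Y\<^sup>2) - 2 * (1 - s\<^sup>2) * Z"
  proof -
    have "0 \<le> (1 + s\<^sup>2) * X\<^sup>2" by simp
    moreover have "(1 + s\<^sup>2) * (X\<^sup>2 + Y\<^sup>2) - 2 * (1 - s\<^sup>2) * Z
        = (1 + s\<^sup>2) * X\<^sup>2 + (1 + s\<^sup>2) * Y\<^sup>2 - 2 * ((1 - s\<^sup>2) * Z)"
      by (simp add: algebra_simps)
    moreover have "4 * (1 - s) * X * Y = 2 * (2 * (1 - s) * X * Y)" by simp
    ultimately show ?thesis using Z' by linarith
  qed
  also have "\<dots> = (X\<^sup>2 - 2 * Z + Y\<^sup>2) + s\<^sup>2 * (X\<^sup>2 + 2 * Z + Y\<^sup>2)"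
    by (simp add: algebra_simps)
  finally have "2 * s * Y\<^sup>2 + (q\<^sup>2 - 4 * q * X) \<le> (X\<^sup>2 - 2 * Z + Y\<^sup>2) + s\<^sup>2 * (X\<^sup>2 + 2 * Z + Y\<^sup>2)" .
  then have "(2 * s * Y\<^sup>2 + (q\<^sup>2 - 4 * q * X)) / (4 * s)
      \<le> ((X\<^sup>2 - 2 * Z + Y\<^sup>2) + s\<^sup>2 * (X\<^sup>2 + 2 * Z + Y\<^sup>2)) / (4 * s)"
    using s by (intro divide_right_mono) auto
  moreover have "(2 * s * Y\<^sup>2 + (q\<^sup>2 - 4 * q * X)) / (4 * s) = Y\<^sup>2 / 2 + (q\<^sup>2 - 4 * q * X) / (4 * s)"
    using s by (simp add: add_divide_distrib)
  moreover have "((X\<^sup>2 - 2 * Z + Y\<^sup>2) + s\<^sup>2 * (X\<^sup>2 + 2 * Z + Y\<^sup>2)) / (4 * s)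
      = (1/4) * ((X\<^sup>2 - 2 * Z + Y\<^sup>2) / s + s * (X\<^sup>2 + 2 * Z + Y\<^sup>2))"
    using s by (simp add: add_divide_distrib power2_eq_square)
  ultimately show ?thesis
    unfolding n X_def[symmetric] Y_def[symmetric] by linarith
qed

text \<open>
  Two regimes meet.  For \<open>s \<ge> 1/2\<close> the power of \<open>s\<close> is harmless and completing the square in \<open>q\<close> costs
  a constant.  For \<open>s < 1/2\<close> the singular power of \<open>s\<close> is compensated by a factor
  \<open>exp (- \<eta>\<^sup>2 / (64 * s))\<close>, available because \<open>x\<close> is small compared with \<open>y\<close> and hence
  \<open>4 * norm x \<le> q / 2\<close>.
\<close>

lemma mehler_off_diagonal:
  fixes x y :: "'a::euclidean_space"
  assumes s: "0 < s" "s < 1" and \<eta>: "0 < \<eta>" "\<eta> \<le> 1" and x: "norm x \<le> \<eta> / 16" and y: "\<eta> \<le> norm y"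
    and p: "0 < p"
  defines "q \<equiv> (1 - s) * norm y"
  shows "s powr (- p) * exp (- (1/4) * ((norm (x - y))\<^sup>2 / s + s * (norm (x + y))\<^sup>2))
    \<le> (2 powr p * exp 1 + (64 / \<eta>\<^sup>2) powr p * p powr p) * (exp (- (norm y)\<^sup>2 / 2) * exp (- q\<^sup>2 / 8))"
proof -
  define X Y where "X = norm x" and "Y = norm y"
  have XY: "0 \<le> X" "X \<le> \<eta> / 16" "\<eta> \<le> Y" using x y by (simp_all add: X_def Y_def)
  have q0: "0 \<le> q" "q = (1 - s) * Y" using s XY \<eta> by (simp_all add: q_def Y_def)
  define e where "e = - ((q\<^sup>2 - 4 * q * X) / (4 * s))"
  have main: "s powr (- p) * exp e \<le> (2 powr p * exp 1 + (64 / \<eta>\<^sup>2) powr p * p powr p) * exp (- q\<^sup>2 / 8)"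
  proof (cases "1/2 \<le> s")
    case True
    have "q\<^sup>2 / 2 - 8 * X\<^sup>2 \<le> q\<^sup>2 - 4 * q * X"
      using zero_le_power2[of "q - 4 * X"] by (simp add: power2_eq_square algebra_simps)
    then have "e \<le> - (q\<^sup>2 / 2 - 8 * X\<^sup>2) / (4 * s)"
      unfolding e_def minus_divide_left using s by (intro divide_right_mono) auto
    also have "\<dots> = 2 * X\<^sup>2 / s - q\<^sup>2 / (8 * s)" using s by (simp add: field_simps)
    also have "\<dots> \<le> 1 - q\<^sup>2 / 8"
    proof (rule diff_mono)
      have "X\<^sup>2 \<le> (1/16)\<^sup>2" using XY \<eta> by (intro power_mono) auto
      then have "2 * X\<^sup>2 \<le> s" using True by (simp add: power2_eq_square)
      then show "2 * X\<^sup>2 / s \<le> 1" using s by simp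
      show "q\<^sup>2 / 8 \<le> q\<^sup>2 / (8 * s)" using s by (intro divide_left_mono) auto
    qed
    finally have "exp e \<le> exp 1 * exp (- q\<^sup>2 / 8)" by (simp add: exp_add[symmetric])
    moreover have "s powr (- p) \<le> 2 powr p"
    proof -
      have "s powr (- p) = (1 / s) powr p" using s by (simp add: powr_minus powr_divide divide_simps)
      also have "\<dots> \<le> 2 powr p" using True s p by (intro powr_mono2) (auto simp: field_simps)
      finally show ?thesis .
    qed
    ultimately have "s powr (- p) * exp e \<le> 2 powr p * (exp 1 * exp (- q\<^sup>2 / 8))"
      by (intro mult_mono) auto
    also have "\<dots> \<le> (2 powr p * exp 1 + (64 / \<eta>\<^sup>2) powr p * p powr p) * exp (- q\<^sup>2 / 8)"
      by (simp add: distrib_right)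
    finally show ?thesis .
  next
    case False
    have "4 * X \<le> q / 2"
    proof -
      have "1/2 * Y \<le> (1 - s) * Y" using False XY \<eta> by (intro mult_right_mono) auto
      then show ?thesis using XY by (simp add: q0)
    qed
    then have "q * (4 * X) \<le> q * (q / 2)" using q0 by (intro mult_left_mono) auto
    then have "q\<^sup>2 / 2 \<le> q\<^sup>2 - 4 * q * X" by (simp add: power2_eq_square)
    then have "e \<le> - (q\<^sup>2 / 2) / (4 * s)"
      unfolding e_def minus_divide_left using s by (intro divide_right_mono) auto
    also have "\<dots> = - q\<^sup>2 / 8 - q\<^sup>2 * (1 - s) / (8 * s)" using s by (simp add: field_simps)
    also have "\<dots> \<le> - q\<^sup>2 / 8 - \<eta>\<^sup>2 / (64 * s)"
    proof -
      have "1/2 * \<eta> \<le> (1 - s) * Y" using False XY \<eta> s by (intro mult_mono) auto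
      then have "(1/2 * \<eta>)\<^sup>2 \<le> q\<^sup>2" using \<eta> by (simp add: q0 power_mono)
      then have "(1/2 * \<eta>)\<^sup>2 * (1/2) \<le> q\<^sup>2 * (1 - s)" using False by (intro mult_mono) auto
      then have "(1/2 * \<eta>)\<^sup>2 * (1/2) / (8 * s) \<le> q\<^sup>2 * (1 - s) / (8 * s)"
        using s by (intro divide_right_mono) auto
      then show ?thesis by (simp add: power_mult_distrib power_divide)
    qed
    finally have e: "exp e \<le> exp (- q\<^sup>2 / 8) * exp (- (\<eta>\<^sup>2 / (64 * s)))"
      by (simp add: exp_add[symmetric])
    have "s powr (- p) = (64 / \<eta>\<^sup>2 * (\<eta>\<^sup>2 / (64 * s))) powr p"
      using s \<eta> by (simp add: powr_minus powr_divide divide_simps)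
    also have "\<dots> = (64 / \<eta>\<^sup>2) powr p * (\<eta>\<^sup>2 / (64 * s)) powr p"
      by (rule powr_mult)
    also have "\<dots> \<le> (64 / \<eta>\<^sup>2) powr p * (p powr p * exp (\<eta>\<^sup>2 / (64 * s)))"
      using s p by (intro mult_left_mono powr_le_exp) auto
    finally have "s powr (- p) * exp e \<le> ((64 / \<eta>\<^sup>2) powr p * (p powr p * exp (\<eta>\<^sup>2 / (64 * s))))
        * (exp (- q\<^sup>2 / 8) * exp (- (\<eta>\<^sup>2 / (64 * s))))"
      using e by (intro mult_mono) auto
    also have "\<dots> = (64 / \<eta>\<^sup>2) powr p * p powr p * exp (- q\<^sup>2 / 8)"
      by (simp add: exp_minus)
    also have "\<dots> \<le> (2 powr p * exp 1 + (64 / \<eta>\<^sup>2) powr p * p powr p) * exp (- q\<^sup>2 / 8)"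
      by (simp add: distrib_right)
    finally show ?thesis .
  qed
  have "- (1/4) * ((norm (x - y))\<^sup>2 / s + s * (norm (x + y))\<^sup>2) \<le> - (norm y)\<^sup>2 / 2 + e"
    using mehler_exponent_le[OF s, of x y] unfolding e_def X_def q_def diff_conv_add_uminus .
  then have "exp (- (1/4) * ((norm (x - y))\<^sup>2 / s + s * (norm (x + y))\<^sup>2)) \<le> exp (- (norm y)\<^sup>2 / 2) * exp e"
    unfolding exp_add[symmetric] by (rule exp_mono)
  then have "s powr (- p) * exp (- (1/4) * ((norm (x - y))\<^sup>2 / s + s * (norm (x + y))\<^sup>2))
      \<le> s powr (- p) * (exp (- (norm y)\<^sup>2 / 2) * exp e)"
    by (intro mult_left_mono) auto
  also have "\<dots> = exp (- (norm y)\<^sup>2 / 2) * (s powr (- p) * exp e)" by simp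
  also have "\<dots> \<le> exp (- (norm y)\<^sup>2 / 2) * ((2 powr p * exp 1 + (64 / \<eta>\<^sup>2) powr p * p powr p) * exp (- q\<^sup>2 / 8))"
    by (intro mult_left_mono main) simp
  finally show ?thesis by (simp only: mult_ac)
qed

text \<open>
  A single lower bound that keeps the behaviour of \<^const>\<open>kappa\<close> at both ends, linear at 0 and logarithmic
  at 1.
\<close>

lemma kappa_ge_log:
  assumes "0 < s" "s < 1"
  shows "s * (1 - ln (1 - s)) \<le> kappa s"
proof -
  define w where "w = - ln (1 - s)"
  have "ln (1 - s) \<le> (1 - s) - 1" using assms by (intro ln_le_minus_one) auto
  then have w: "s \<le> w" by (simp add: w_def)
  have "s * w \<le> 1 * w" using assms w by (intro mult_right_mono) auto
  then have "s * (1 + w) \<le> 2 * w" using w by (simp add: distrib_left)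
  also have "\<dots> \<le> kappa s"
    using assms by (simp add: kappa_def ln_div w_def)
  finally show ?thesis by (simp add: w_def)
qed

text \<open>
  The logarithm in \<^const>\<open>Phi\<close> comes from \<open>kappa s\<close>, which grows like \<open>2 * ln (1 / (1 - s))\<close> as \<open>s\<close> tends to 1.
  With \<open>a = 1 - s\<close> the values \<open>a\<close> of order \<open>1 / Y\<close> matter; this estimate replaces \<open>1 - ln a = ln (e / a)\<close> by
  \<open>ln (e + Y)\<close> at the price of a power of \<open>1 + a * Y\<close>.  It rests on
  \<open>e + Y \<le> (e / a) * (1 + a * Y)\<close>.
\<close>

lemma log_scale_comparison:
  fixes a Y :: real
  assumes a: "0 < a" "a < 1" and Y: "0 \<le> Y"
  shows "(1 - ln a) powr (- (3/2)) \<le> ln (exp 1 + Y) powr (- (3/2)) * (1 + a * Y) powr (3/2)"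
proof -
  have l: "1 \<le> 1 - ln a" using a ln_le_minus_one[of a] by linarith
  have L: "0 < ln (exp 1 + Y)"
    using Y ln_mono[of "exp 1" "exp 1 + Y"] by simp
  have "exp 1 + Y \<le> exp 1 / a * (1 + a * Y)"
  proof -
    have "exp 1 \<le> exp 1 / a" using a by (simp add: field_simps)
    moreover have "Y \<le> exp 1 * Y" using mult_right_mono[of 1 "exp 1" Y] Y by simp
    moreover have "exp 1 / a * (1 + a * Y) = exp 1 / a + exp 1 * Y" using a by (simp add: field_simps)
    ultimately show ?thesis by linarith
  qed
  then have "ln (exp 1 + Y) \<le> ln (exp 1 / a * (1 + a * Y))"
    using Y by (intro ln_mono) (auto intro: add_pos_nonneg)
  also have "\<dots> = (1 - ln a) + ln (1 + a * Y)"
    using a add_pos_nonneg[of 1 "a * Y"] Y by (subst ln_mult) (auto simp: ln_div)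
  also have "\<dots> \<le> (1 - ln a) + a * Y"
    using a Y by (intro add_left_mono ln_add_one_self_le_self) auto
  also have "\<dots> \<le> (1 - ln a) + (1 - ln a) * (a * Y)"
    using mult_right_mono[OF l, of "a * Y"] a Y by simp
  finally have "ln (exp 1 + Y) \<le> (1 - ln a) * (1 + a * Y)" by (simp add: distrib_left)
  then have "ln (exp 1 + Y) powr (3/2) \<le> (1 - ln a) powr (3/2) * (1 + a * Y) powr (3/2)"
    using L l a Y by (subst powr_mult[symmetric]) (auto intro: powr_mono2)
  moreover have "0 < ln (exp 1 + Y) powr (3/2)" "0 < (1 - ln a) powr (3/2)" using L l by auto
  ultimately show ?thesis
    by (simp add: powr_minus field_simps)
qed

lemma gaussian_absorbs_power:
  fixes q :: real
  assumes "0 \<le> q"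
  shows "(1 + q) powr (3/2) * exp (- q\<^sup>2 / 8) \<le> 2 * exp 8 * exp (- q)"
proof -
  have "(1 + q) powr (3/2) \<le> (1 + q) powr 2" using assms by (intro powr_mono) auto
  also have "\<dots> = (1 + q)\<^sup>2" using assms by simp
  also have "\<dots> \<le> 2 * exp q"
    using exp_lower_Taylor_quadratic[OF assms] by (simp add: power2_eq_square algebra_simps)
  finally have "(1 + q) powr (3/2) * exp (- q\<^sup>2 / 8) \<le> 2 * exp q * exp (- q\<^sup>2 / 8)"
    by (rule mult_right_mono) simp
  also have "\<dots> \<le> 2 * (exp 8 * exp (- q))"
  proof -
    have "q + - q\<^sup>2 / 8 \<le> 8 + - q"
      using zero_le_power2[of "q - 8"] by (simp add: power2_eq_square algebra_simps)
    then show ?thesis by (simp add: exp_add[symmetric])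
  qed
  finally show ?thesis by simp
qed

text \<open>
  The substitution \<open>q = (1 - s) * Y\<close> produces the power \<open>Y powr (- h)\<close>.  For \<open>h = d / 2\<close> and \<open>Y\<close> bounded away
  from 0 it is of the same order as the power in \<^const>\<open>Phi\<close>.
\<close>

lemma nn_integral_gamma_scaled:
  assumes h: "0 < h" and Y: "0 < Y"
  shows "(\<integral>\<^sup>+ s. ennreal (indicator {0<..<1} s * ((1 - s) powr (h - 1) * exp (- ((1 - s) * Y)))) \<partial>lborel)
    \<le> ennreal (Gamma h / Y powr h)"
proof -
  define f where "f q = ennreal (indicator {0..} q * (q powr (h - 1) / exp q))" for q :: real
  have [measurable]: "f \<in> borel_measurable borel" unfolding f_def[abs_def] by measurable
  have "integral\<^sup>N lborel f = ennreal (Gamma h)"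
    unfolding f_def by (rule nn_integral_has_integral_lebesgue[OF _ Gamma_integral_real[OF h]]) auto
  moreover have "integral\<^sup>N lborel f = ennreal \<bar>- Y\<bar> * (\<integral>\<^sup>+ s. f (Y + (- Y) * s) \<partial>lborel)"
    using Y by (intro nn_integral_real_affine) auto
  ultimately have G: "ennreal Y * (\<integral>\<^sup>+ s. f (Y + (- Y) * s) \<partial>lborel) = ennreal (Gamma h)"
    using Y by simp
  have "(\<integral>\<^sup>+ s. ennreal (indicator {0<..<1} s * ((1 - s) powr (h - 1) * exp (- ((1 - s) * Y)))) \<partial>lborel)
      \<le> (\<integral>\<^sup>+ s. ennreal (1 / Y powr (h - 1)) * f (Y + (- Y) * s) \<partial>lborel)"
  proof (rule nn_integral_mono)
    fix s :: real
    show "ennreal (indicator {0<..<1} s * ((1 - s) powr (h - 1) * exp (- ((1 - s) * Y))))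
        \<le> ennreal (1 / Y powr (h - 1)) * f (Y + (- Y) * s)"
    proof (cases "s \<in> {0<..<1}")
      case True
      have e: "Y + (- Y) * s = (1 - s) * Y" by (simp add: algebra_simps)
      have "0 \<le> (1 - s) * Y" using True Y by simp
      then show ?thesis
        using True Y unfolding f_def e
        by (simp add: ennreal_mult'[symmetric] powr_mult exp_minus divide_inverse)
    qed simp
  qed
  also have "\<dots> = ennreal (1 / Y powr (h - 1)) * (\<integral>\<^sup>+ s. f (Y + (- Y) * s) \<partial>lborel)"
    by (rule nn_integral_cmult) measurable
  also have "\<dots> = ennreal (1 / Y powr h) * (ennreal Y * (\<integral>\<^sup>+ s. f (Y + (- Y) * s) \<partial>lborel))"
    using Y by (simp add: mult.assoc[symmetric] ennreal_mult'[symmetric] powr_diff)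
  also have "\<dots> = ennreal (Gamma h / Y powr h)"
    unfolding G using h by (simp add: ennreal_mult'[symmetric] Gamma_real_pos)
  finally show ?thesis .
qed


lemma Phi_measurable [measurable]: "Phi \<in> borel_measurable borel"
  unfolding Phi_def[abs_def] by measurable

text \<open>
  Off the origin the kernel is bounded by \<open>t * Phi y\<close>, so that mass away from the origin contributes
  \<open>O(t)\<close>.  The factor \<open>t\<close> is the one in front of the Levy density; the three factors of \<^const>\<open>Phi\<close> come from
  the lemmas above: the Gaussian from \<open>mehler_off_diagonal\<close>, the logarithm from \<open>kappa_ge_log\<close> and
  \<open>log_scale_comparison\<close>, the power from \<open>nn_integral_gamma_scaled\<close>.
\<close>

lemma poisson_density_tail:
  assumes \<eta>: "0 < \<eta>" "\<eta> \<le> 1"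
  shows "\<exists>C\<ge>0. \<forall>t>0. \<forall>x y :: 'a::euclidean_space. norm x \<le> \<eta> / 16 \<longrightarrow> \<eta> \<le> norm y \<longrightarrow>
    poisson_density t x y \<le> ennreal (C * t * Phi y)"
proof -
  define h where "h = real DIM('a) / 2"
  have h: "0 < h" by (simp add: h_def)
  define p where "p = h + 3/2"
  have p: "0 < p" using h by (simp add: p_def)
  define C1 where "C1 = 2 powr p * exp 1 + (64 / \<eta>\<^sup>2) powr p * p powr p"
  define K where "K = 4 * 2 powr h / ((4 * pi) powr h * sqrt pi)"
  define C where "C = K * C1 * (2 * exp 8) * Gamma h * (2 / \<eta>) powr h"
  have C1: "0 \<le> C1" and K: "0 \<le> K" by (auto simp: C1_def K_def)
  have G: "0 < Gamma h" using h by (rule Gamma_real_pos)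
  have C: "0 \<le> C" using C1 K G by (simp add: C_def)
  have "poisson_density t x y \<le> ennreal (C * t * Phi y)"
    if t: "0 < t" and x: "norm x \<le> \<eta> / 16" and y: "\<eta> \<le> norm y" for t and x y :: 'a
  proof -
    define Y where "Y = norm y"
    have Y: "0 < Y" "\<eta> \<le> Y" using y \<eta> by (auto simp: Y_def)
    define L where "L = ln (exp 1 + Y)"
    have L: "0 < L" using Y ln_mono[of "exp 1" "exp 1 + Y"] by (simp add: L_def)
    define B where "B = t * K * C1 * (2 * exp 8) * exp (- Y\<^sup>2 / 2) * L powr (- (3/2))"
    have B: "0 \<le> B" using t K C1 by (simp add: B_def)
    have bound: "levy_density t s * mehler_kernel s x y \<le> B * ((1 - s) powr (h - 1) * exp (- ((1 - s) * Y)))"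
      if s: "0 < s" "s < 1" for s
    proof -
      define a where "a = 1 - s"
      have a: "0 < a" "a < 1" using s by (auto simp: a_def)
      define q where "q = a * Y"
      have q: "0 \<le> q" using a Y by (simp add: q_def)
      define M where "M = 1 - ln a"
      have M: "1 \<le> M" using a ln_le_minus_one[of a] unfolding M_def by linarith
      have k: "0 < kappa s" using s by (rule kappa_pos)
      have s2: "0 < 1 - s\<^sup>2" using s by (simp add: power_less_one_iff)
      define E where "E = exp (- (1/4) * ((norm (x - y))\<^sup>2 / s + s * (norm (x + y))\<^sup>2))"
      define W where "W = (4 / (1 - s\<^sup>2)) / sqrt pi * ((1 - s\<^sup>2) / (4 * pi * s)) powr h"
      have "(1 + s) powr (h - 1) \<le> 2 powr h"
      proof -
        have "(1 + s) powr (h - 1) \<le> (1 + s) powr h" using s by (intro powr_mono) auto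
        also have "\<dots> \<le> 2 powr h" using s h by (intro powr_mono2) auto
        finally show ?thesis .
      qed
      moreover have "1 - s\<^sup>2 = (1 + s) * a" by (simp add: a_def power2_eq_square algebra_simps)
      then have "(1 - s\<^sup>2) powr (h - 1) = (1 + s) powr (h - 1) * a powr (h - 1)"
        by (simp add: powr_mult)
      ultimately have ps: "(1 - s\<^sup>2) powr (h - 1) \<le> 2 powr h * a powr (h - 1)"
        by (simp add: mult_right_mono)
      have "W = 4 / ((4 * pi) powr h * sqrt pi) * (1 - s\<^sup>2) powr (h - 1) * s powr (- h)"
      proof -
        have "((1 - s\<^sup>2) / (4 * pi * s)) powr h = (1 - s\<^sup>2) powr h / ((4 * pi) powr h * s powr h)"
          by (simp only: powr_divide powr_mult[of "4 * pi" s])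
        moreover have "(1 - s\<^sup>2) powr (h - 1) = (1 - s\<^sup>2) powr h / (1 - s\<^sup>2)"
          using s2 by (simp add: powr_diff)
        moreover have "s powr (- h) = 1 / s powr h" by (simp add: powr_minus divide_inverse)
        ultimately show ?thesis unfolding W_def by simp
      qed
      also have "\<dots> \<le> 4 / ((4 * pi) powr h * sqrt pi) * (2 powr h * a powr (h - 1)) * s powr (- h)"
        using ps by (intro mult_right_mono mult_left_mono) auto
      finally have W: "W \<le> K * a powr (h - 1) * s powr (- h)" by (simp add: K_def mult_ac)
      have W0: "0 \<le> W" using s2 by (simp add: W_def)
      have kl: "kappa s powr (- (3/2)) \<le> s powr (- (3/2)) * M powr (- (3/2))"
      proof -
        have "kappa s powr (- (3/2)) \<le> (s * M) powr (- (3/2))"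
        proof (rule powr_mono2')
          show "0 < s * M" using s M by simp
          show "s * M \<le> kappa s" unfolding M_def a_def by (rule kappa_ge_log[OF s])
        qed simp
        then show ?thesis by (simp add: powr_mult)
      qed
      have "levy_density t s * mehler_kernel s x y
          = t * exp (- t\<^sup>2 / kappa s) * kappa s powr (- (3/2)) * W * E"
        unfolding levy_density_def mehler_kernel_def W_def E_def h_def by (simp add: mult_ac)
      also have "\<dots> \<le> t * 1 * (s powr (- (3/2)) * M powr (- (3/2))) * (K * a powr (h - 1) * s powr (- h)) * E"
        using t k W W0 kl K by (intro mult_mono) (auto simp: E_def)
      also have "\<dots> = t * K * a powr (h - 1) * (M powr (- (3/2)) * (s powr (- p) * E))"
      proof -
        have "- p = - (3/2) + - h" by (simp add: p_def)
        then have "s powr (- p) = s powr (- (3/2)) * s powr (- h)" by (simp only: powr_add)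
        then show ?thesis by simp
      qed
      also have "\<dots> \<le> t * K * a powr (h - 1) *
          ((L powr (- (3/2)) * (1 + q) powr (3/2)) * (C1 * (exp (- Y\<^sup>2 / 2) * exp (- q\<^sup>2 / 8))))"
      proof (rule mult_left_mono, rule mult_mono)
        show "M powr (- (3/2)) \<le> L powr (- (3/2)) * (1 + q) powr (3/2)"
          unfolding M_def L_def q_def using a Y by (intro log_scale_comparison) auto
        show "s powr (- p) * E \<le> C1 * (exp (- Y\<^sup>2 / 2) * exp (- q\<^sup>2 / 8))"
          unfolding C1_def E_def q_def a_def Y_def using s \<eta> x y p by (rule mehler_off_diagonal)
      qed (use t K in \<open>auto simp: E_def\<close>)
      also have "\<dots> = t * K * C1 * exp (- Y\<^sup>2 / 2) * L powr (- (3/2)) * a powr (h - 1)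
          * ((1 + q) powr (3/2) * exp (- q\<^sup>2 / 8))" by simp
      also have "\<dots> \<le> t * K * C1 * exp (- Y\<^sup>2 / 2) * L powr (- (3/2)) * a powr (h - 1) * (2 * exp 8 * exp (- q))"
        using t K C1 q by (intro mult_left_mono gaussian_absorbs_power) auto
      also have "\<dots> = B * ((1 - s) powr (h - 1) * exp (- ((1 - s) * Y)))"
        unfolding B_def q_def a_def by (simp add: mult_ac)
      finally show ?thesis .
    qed
    have "poisson_density t x y
        = (\<integral>\<^sup>+ s. ennreal (indicator {0<..<1} s * levy_density t s) * ennreal (mehler_kernel s x y) \<partial>lborel)"
      unfolding poisson_density_def by (rule nn_integral_poisson_clock) (unfold mehler_kernel_def, measurable)
    also have "\<dots> \<le> (\<integral>\<^sup>+ s. ennreal B * ennreal (indicator {0<..<1} s * ((1 - s) powr (h - 1) * exp (- ((1 - s) * Y)))) \<partial>lborel)"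
      using bound B t by (intro nn_integral_mono)
        (auto split: split_indicator simp: ennreal_mult'[symmetric] ennreal_mult''[symmetric] mehler_kernel_nonneg levy_density_nonneg intro!: ennreal_leI)
    also have "\<dots> = ennreal B * (\<integral>\<^sup>+ s. ennreal (indicator {0<..<1} s * ((1 - s) powr (h - 1) * exp (- ((1 - s) * Y)))) \<partial>lborel)"
      by (rule nn_integral_cmult) measurable
    also have "\<dots> \<le> ennreal B * ennreal (Gamma h / Y powr h)"
      using h Y by (intro mult_left_mono nn_integral_gamma_scaled) auto
    also have "\<dots> = ennreal (B * (Gamma h / Y powr h))"
      by (rule ennreal_mult'[OF B, symmetric])
    also have "\<dots> \<le> ennreal (C * t * Phi y)"
    proof (rule ennreal_leI)
      have "1 \<le> Y / \<eta>" "Y \<le> Y / \<eta>" using Y \<eta> by (simp_all add: field_simps)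
      then have "1 + Y \<le> 2 / \<eta> * Y" by simp
      then have "(1 + Y) powr h \<le> (2 / \<eta> * Y) powr h" using Y h by (intro powr_mono2) auto
      then have "(1 + Y) powr h \<le> (2 / \<eta>) powr h * Y powr h" by (simp only: powr_mult)
      moreover have "0 < (1 + Y) powr h" "0 < Y powr h" using Y by auto
      ultimately have Yh: "1 / Y powr h \<le> (2 / \<eta>) powr h / (1 + Y) powr h"
        by (simp add: divide_simps mult_ac)
      have "B * (Gamma h / Y powr h) = B * Gamma h * (1 / Y powr h)" by simp
      also have "\<dots> \<le> B * Gamma h * ((2 / \<eta>) powr h / (1 + Y) powr h)"
        using B G by (intro mult_left_mono Yh) auto
      also have "\<dots> = C * t * Phi y"
        unfolding B_def C_def Phi_def Y_def[symmetric] L_def[symmetric] h_def[symmetric]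
          powr_minus_divide[of L] by (simp add: mult_ac)
      finally show "B * (Gamma h / Y powr h) \<le> C * t * Phi y" .
    qed
    finally show ?thesis .
  qed
  with C show ?thesis by blast
qed


section \<open>Integration against measures that integrate the weight\<close>

lemma Phi_le_gaussian:
  fixes y :: "'a::euclidean_space"
  shows "Phi y \<le> exp (- (1/2 * (norm (y - 0))\<^sup>2))"
proof -
  have "1 \<le> ln (exp 1 + norm y)" using ln_mono[of "exp 1" "exp 1 + norm y"] by simp
  then have "1 * 1 \<le> (1 + norm y) powr (real DIM('a) / 2) * ln (exp 1 + norm y) powr (3/2)"
    by (intro mult_mono ge_one_powr_ge_zero) auto
  then show ?thesis
    unfolding Phi_def by (simp add: divide_le_eq)
qed

lemma nn_integral_Phi_lborel: "(\<integral>\<^sup>+ y. ennreal (Phi (y :: 'a::euclidean_space)) \<partial>lborel) < \<infinity>"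
proof -
  have "(\<integral>\<^sup>+ y. ennreal (Phi (y :: 'a)) \<partial>lborel) \<le> (\<integral>\<^sup>+ y. ennreal (exp (- (1/2 * (norm (y - 0 :: 'a))\<^sup>2))) \<partial>lborel)"
    by (intro nn_integral_mono ennreal_leI Phi_le_gaussian)
  also have "\<dots> = (\<integral>\<^sup>+ v. emeasure lborel (ball (0::'a) (sqrt (v / (1/2)))) \<partial>unit_exponential)"
    by (rule gaussian_layer_cake) (auto intro: lborel.sigma_finite_measure_axioms)
  also have "\<dots> = ennreal ((pi / (1/2)) powr (real DIM('a) / 2))"
    by (rule exponential_ball_volume) simp
  finally show ?thesis by (simp add: order_le_less_trans)
qed

lemma emeasure_ball_finite_if_Phi_integrable:
  fixes m :: "'a::euclidean_space measure"
  assumes [simp, measurable_cong]: "sets m = sets borel" and fin: "(\<integral>\<^sup>+ y. ennreal (Phi y) \<partial>m) < \<infinity>"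
  shows "emeasure m (ball z r) < \<infinity>"
proof (cases "0 < r")
  case True
  define R where "R = norm z + r"
  have R: "0 < R" using True by (simp add: R_def add_nonneg_pos)
  define c where "c = exp (- R\<^sup>2 / 2) / ((1 + R) powr (real DIM('a) / 2) * ln (exp 1 + R) powr (3/2))"
  have L: "1 \<le> ln (exp 1 + s)" if "0 \<le> s" for s :: real using ln_mono[of "exp 1" "exp 1 + s"] that by simp
  have c: "0 < c" unfolding c_def using R L[of R] by auto
  have "c \<le> Phi y" if "y \<in> ball z r" for y :: 'a
  proof -
    have "norm y \<le> norm z + dist z y" by (metis dist_norm norm_triangle_sub norm_minus_commute)
    with that have y: "norm y \<le> R" by (simp add: R_def)
    then have "exp (- R\<^sup>2 / 2) \<le> exp (- (norm y)\<^sup>2 / 2)" by (simp add: power_mono)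
    moreover have "ln (exp 1 + norm y) \<le> ln (exp 1 + R)"
      using y by (intro ln_mono) (auto intro: add_pos_nonneg)
    then have "(1 + norm y) powr (real DIM('a) / 2) * ln (exp 1 + norm y) powr (3/2)
        \<le> (1 + R) powr (real DIM('a) / 2) * ln (exp 1 + R) powr (3/2)"
      using y L[of "norm y"] by (intro mult_mono powr_mono2) auto
    moreover have "0 < (1 + norm y) powr (real DIM('a) / 2) * ln (exp 1 + norm y) powr (3/2)"
      using L[of "norm y"] by (intro mult_pos_pos) (auto simp: add_nonneg_eq_0_iff)
    ultimately show ?thesis unfolding c_def Phi_def by (intro frac_le) auto
  qed
  then have "(\<integral>\<^sup>+ y. ennreal c * indicator (ball z r) y \<partial>m) \<le> (\<integral>\<^sup>+ y. ennreal (Phi y) \<partial>m)"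
    by (intro nn_integral_mono) (auto split: split_indicator intro!: ennreal_leI)
  then have "ennreal c * emeasure m (ball z r) < \<infinity>"
    using fin by (simp add: nn_integral_cmult_indicator order_le_less_trans)
  then show ?thesis
    using c by (auto simp: ennreal_mult_less_top)
next
  case False
  then show ?thesis by (simp add: ball_empty)
qed

lemma sigma_finite_measure_if_Phi_integrable:
  fixes m :: "'a::euclidean_space measure"
  assumes m: "sets m = sets borel" and fin: "(\<integral>\<^sup>+ y. ennreal (Phi y) \<partial>m) < \<infinity>"
  shows "sigma_finite_measure m"
proof
  have "space m = UNIV" using sets_eq_imp_space_eq[OF m] by simp
  moreover have "(\<Union>k::nat. ball (0::'a) (real k)) = UNIV"
    using reals_Archimedean2 by auto
  ultimately show "\<exists>A. countable A \<and> A \<subseteq> sets m \<and> \<Union>A = space m \<and> (\<forall>a\<in>A. emeasure m a \<noteq> \<infinity>)"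
    using emeasure_ball_finite_if_Phi_integrable[OF m fin]
    by (intro exI[of _ "range (\<lambda>k::nat. ball 0 (real k))"]) (auto simp: m less_top)
qed

text \<open>
  Only balls of radius below \<open>2 * \<eta>\<close> see the mass in \<open>ball 0 \<eta>\<close> fully: a point of \<open>ball 0 \<eta>\<close> has
  distance less than \<open>2 * \<eta>\<close> from any centre \<open>z\<close> with \<open>norm z \<le> \<eta>\<close>.  Thus the radii may be cut off at
  \<open>2 * \<eta>\<close>, where information on small balls about the origin applies, and the mass outside
  \<open>ball 0 \<eta>\<close> is left to the tail estimate.
\<close>

lemma poisson_truncation:
  fixes m :: "'a::euclidean_space measure"
  assumes t: "0 < t" and x: "norm x \<le> \<eta>"
    and [simp, measurable_cong]: "sets m = sets borel" and fin: "(\<integral>\<^sup>+ y. ennreal (Phi y) \<partial>m) < \<infinity>"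
  shows "(\<integral>\<^sup>+ y. poisson_density t x y \<partial>m)
    \<le> ball_average t x (\<lambda>z r. emeasure m (ball z (min r (2 * \<eta>))))
      + (\<integral>\<^sup>+ y. poisson_density t x y * indicator {y. \<eta> \<le> norm y} y \<partial>m)"
proof -
  have [measurable]: "poisson_density t x \<in> borel_measurable m"
    using poisson_density_measurable[OF t] by (simp add: measurable_cong_sets[OF assms(3) refl])
  have [measurable]: "ball 0 \<eta> \<in> sets m" "{y. \<eta> \<le> norm y} \<in> sets m" by simp_all
  define m' where "m' = density m (indicator (ball 0 \<eta>))"
  have em': "emeasure m' A = emeasure m (ball 0 \<eta> \<inter> A)" if "A \<in> sets borel" for A
  proof -
    have "emeasure m' A = (\<integral>\<^sup>+ y. indicator (ball 0 \<eta>) y * indicator A y \<partial>m)"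
      unfolding m'_def using that by (intro emeasure_density borel_measurable_indicator) auto
    also have "\<dots> = (\<integral>\<^sup>+ y. indicator (ball 0 \<eta> \<inter> A) y \<partial>m)"
      by (simp add: indicator_inter_arith)
    finally show ?thesis using that by simp
  qed
  have "emeasure m' (space m') < \<infinity>"
    using em'[of UNIV] emeasure_ball_finite_if_Phi_integrable[OF assms(3) fin, of 0 \<eta>] sets_eq_imp_space_eq[OF assms(3)]
    by (simp add: m'_def)
  then interpret m': finite_measure m' by (intro finite_measureI) auto
  have "(\<integral>\<^sup>+ y. poisson_density t x y \<partial>m) = (\<integral>\<^sup>+ y. indicator (ball 0 \<eta>) y * poisson_density t x y
      + poisson_density t x y * indicator {y. \<eta> \<le> norm y} y \<partial>m)"
    by (intro nn_integral_cong) (auto split: split_indicator)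
  also have "\<dots> = (\<integral>\<^sup>+ y. indicator (ball 0 \<eta>) y * poisson_density t x y \<partial>m)
      + (\<integral>\<^sup>+ y. poisson_density t x y * indicator {y. \<eta> \<le> norm y} y \<partial>m)"
    by (rule nn_integral_add) measurable
  also have "(\<integral>\<^sup>+ y. indicator (ball 0 \<eta>) y * poisson_density t x y \<partial>m) = (\<integral>\<^sup>+ y. poisson_density t x y \<partial>m')"
    unfolding m'_def by (rule nn_integral_density[symmetric]) measurable
  also have "\<dots> = ball_average t x (\<lambda>z r. emeasure m' (ball z r))"
    using t m'.sigma_finite_measure_axioms by (intro nn_integral_poisson_density) (auto simp: m'_def)
  also have "\<dots> \<le> ball_average t x (\<lambda>z r. emeasure m (ball z (min r (2 * \<eta>))))"
  proof (rule ball_average_mono)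
    fix z :: 'a and r :: real assume z: "norm z \<le> norm x"
    have "ball 0 \<eta> \<inter> ball z r \<subseteq> ball z (min r (2 * \<eta>))"
    proof
      fix y assume y: "y \<in> ball 0 \<eta> \<inter> ball z r"
      have "dist z y \<le> norm z + norm y" by (simp add: dist_norm norm_triangle_ineq4)
      with y z x show "y \<in> ball z (min r (2 * \<eta>))" by simp
    qed
    then show "emeasure m' (ball z r) \<le> emeasure m (ball z (min r (2 * \<eta>)))"
      by (subst em') (auto intro!: emeasure_mono)
  qed
  finally show ?thesis by (simp add: add_right_mono)
qed

lemma nn_integral_poisson_tail_le:
  fixes m :: "'a::euclidean_space measure"
  assumes [simp, measurable_cong]: "sets m = sets borel" and C: "0 \<le> C" "0 \<le> t"
    and P: "\<And>y. \<eta> \<le> norm y \<Longrightarrow> poisson_density t x y \<le> ennreal (C * t * Phi y)"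
  shows "(\<integral>\<^sup>+ y. poisson_density t x y * indicator {y. \<eta> \<le> norm y} y \<partial>m)
    \<le> ennreal (C * t) * (\<integral>\<^sup>+ y. ennreal (Phi y) \<partial>m)"
proof -
  have "(\<integral>\<^sup>+ y. poisson_density t x y * indicator {y. \<eta> \<le> norm y} y \<partial>m)
      \<le> (\<integral>\<^sup>+ y. ennreal (C * t) * ennreal (Phi y) \<partial>m)"
    using C P by (intro nn_integral_mono) (auto split: split_indicator simp: ennreal_mult'[symmetric])
  also have "\<dots> = ennreal (C * t) * (\<integral>\<^sup>+ y. ennreal (Phi y) \<partial>m)"
    by (rule nn_integral_cmult) measurable
  finally show ?thesis .
qed

lemma measurable_emeasure_truncated_ball:
  fixes m :: "'a::euclidean_space measure"
  assumes "sigma_finite_measure m" "sets m = sets borel"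
  shows "(\<lambda>(z, r). emeasure m (ball z (min r c))) \<in> borel_measurable (borel \<Otimes>\<^sub>M borel)"
proof -
  have "(\<lambda>(z, r). emeasure m (ball z r)) \<circ> (\<lambda>(z, r). (z, min r c)) \<in> borel_measurable (borel \<Otimes>\<^sub>M borel)"
    by (rule measurable_comp[OF _ measurable_emeasure_ball[OF assms]]) measurable
  then show ?thesis by (simp add: comp_def case_prod_beta)
qed

lemma nn_integral_poisson_density_finite:
  fixes m :: "'a::euclidean_space measure"
  assumes m: "sets m = sets borel" and fin: "(\<integral>\<^sup>+ y. ennreal (Phi y) \<partial>m) < \<infinity>"
    and t: "0 < t" and x: "norm x \<le> 1 / 16"
  shows "(\<integral>\<^sup>+ y. poisson_density t x y \<partial>m) < \<infinity>"
proof -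
  obtain C where C: "0 \<le> C" "\<And>y. 1 \<le> norm y \<Longrightarrow> poisson_density t x y \<le> ennreal (C * t * Phi y)"
    using poisson_density_tail[of 1, where 'a='a] t x by auto
  obtain D where D: "ball_average t x (\<lambda>z r. 1) \<le> ennreal (D / t ^ DIM('a))"
    using ball_average_const_le[where 'a='a] t by blast
  have b: "emeasure m (ball 0 3) < \<infinity>" by (rule emeasure_ball_finite_if_Phi_integrable[OF m fin])
  have "(\<integral>\<^sup>+ y. poisson_density t x y \<partial>m)
      \<le> ball_average t x (\<lambda>z r. emeasure m (ball z (min r (2 * 1))))
        + (\<integral>\<^sup>+ y. poisson_density t x y * indicator {y. 1 \<le> norm y} y \<partial>m)"
    using t x m fin by (intro poisson_truncation) auto
  also have "\<dots> \<le> ball_average t x (\<lambda>z r. 0 + emeasure m (ball 0 3) * 1) + ennreal (C * t) * (\<integral>\<^sup>+ y. ennreal (Phi y) \<partial>m)"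
  proof (intro add_mono ball_average_mono nn_integral_poisson_tail_le m C)
    fix z :: 'a and r :: real assume z: "norm z \<le> norm x"
    have "ball z (min r (2 * 1)) \<subseteq> ball 0 3"
    proof
      fix y assume "y \<in> ball z (min r (2 * 1))"
      moreover have "norm y \<le> norm z + dist z y" by (metis dist_norm norm_triangle_sub norm_minus_commute)
      ultimately show "y \<in> ball 0 3" using z x by simp
    qed
    then show "emeasure m (ball z (min r (2 * 1))) \<le> 0 + emeasure m (ball 0 3) * 1"
      by (simp add: emeasure_mono m)
  qed (use t in auto)
  also have "ball_average t x (\<lambda>z r. 0 + emeasure m (ball 0 3) * 1) = emeasure m (ball 0 3) * ball_average t x (\<lambda>z r. 1)"
    by (subst ball_average_linear) (auto simp: ball_average_def)
  also have "emeasure m (ball 0 3) * ball_average t x (\<lambda>z r. 1) + ennreal (C * t) * (\<integral>\<^sup>+ y. ennreal (Phi y) \<partial>m) < \<infinity>"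
    using b fin D by (auto simp: ennreal_mult_less_top order_le_less_trans[OF D])
  finally show ?thesis .
qed

text \<open>
  The mass of the Mehler kernel is close to 1 for small \<open>s\<close>, and the clock gives weight \<open>O(t)\<close> to the other
  values of \<open>s\<close>.
\<close>

lemma poisson_of_one:
  assumes e: "0 < e"
  shows "\<exists>\<delta>>0. \<forall>t x. 0 < t \<longrightarrow> t < \<delta> \<longrightarrow> norm (x::'a::euclidean_space) \<le> 1 \<longrightarrow>
    1 \<le> (\<integral>\<^sup>+ y. poisson_density t x y \<partial>lborel) + ennreal e"
proof -
  define h where "h = real DIM('a) / 2"
  define g where "g s = mehler_contraction s powr h * exp (- s)" for s
  have "isCont g 0"
    unfolding g_def mehler_contraction_def by (intro continuous_intros) auto
  moreover have "g 0 = 1" by (simp add: g_def mehler_contraction_def)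
  ultimately have "\<exists>s1>0. \<forall>s. \<bar>s\<bar> < s1 \<longrightarrow> \<bar>g s - 1\<bar> < e / 2"
    using half_gt_zero[OF e] unfolding continuous_at_eps_delta dist_real_def by (metis diff_zero)
  then obtain s1 where s1: "0 < s1" "\<And>s. \<bar>s\<bar> < s1 \<Longrightarrow> \<bar>g s - 1\<bar> < e / 2"
    by blast
  define s0 where "s0 = min s1 (1/2)"
  have s0: "0 < s0" "s0 < 1" using s1 by (auto simp: s0_def)
  have "1 \<le> (\<integral>\<^sup>+ y. poisson_density t x y \<partial>lborel) + ennreal e"
    if t: "0 < t" "t < e / (2 * exp (1 / kappa s0))" and x: "norm x \<le> 1" for t and x :: 'a
  proof -
    have mass: "1 \<le> mehler_mass s x + e / 2" if s: "0 < s" "s < s0" for s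
    proof -
      have "(norm x)\<^sup>2 \<le> 1 * (1 + s\<^sup>2)" using x by (simp add: power_le_one add_increasing2)
      then have "(norm x)\<^sup>2 / (1 + s\<^sup>2) \<le> 1" by (simp add: divide_le_eq add_pos_nonneg)
      then have "s * ((norm x)\<^sup>2 / (1 + s\<^sup>2)) \<le> s * 1" using s by (intro mult_left_mono) auto
      then have "g s \<le> mehler_mass s x"
        unfolding g_def mehler_mass_def h_def by (intro mult_left_mono) auto
      moreover have "\<bar>g s - 1\<bar> < e / 2" using s1(2)[of s] s by (simp add: s0_def)
      ultimately show ?thesis by linarith
    qed
    have "1 = (\<integral>\<^sup>+ s. 1 \<partial>poisson_clock t)" using t by (simp add: poisson_clock_total)
    also have "\<dots> \<le> (\<integral>\<^sup>+ s. ennreal (mehler_mass s x) + ennreal (e / 2) + indicator {s0..} s \<partial>poisson_clock t)"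
    proof (rule nn_integral_mono_AE, rule eventually_mono[OF AE_poisson_clock])
      fix s :: real assume "0 < s \<and> s < 1"
      then show "1 \<le> ennreal (mehler_mass s x) + ennreal (e / 2) + indicator {s0..} s"
        using mass[of s] e
        by (cases "s < s0") (auto simp: mehler_mass_def ennreal_plus[symmetric] ennreal_1[symmetric] simp del: ennreal_plus ennreal_1 intro!: ennreal_leI)
    qed
    also have "\<dots> = (\<integral>\<^sup>+ s. ennreal (mehler_mass s x) \<partial>poisson_clock t) + ennreal (e / 2) + emeasure (poisson_clock t) {s0..}"
      using t by (subst nn_integral_add, (simp add: mehler_mass_def; fail)+)+ (simp add: poisson_clock_total)
    also have "\<dots> \<le> (\<integral>\<^sup>+ s. ennreal (mehler_mass s x) \<partial>poisson_clock t) + ennreal (e / 2) + ennreal (e / 2)"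
    proof (rule add_left_mono)
      have "emeasure (poisson_clock t) {s0..} \<le> ennreal (t * exp (1 / kappa s0))"
        using t s0 by (intro poisson_clock_large_times)
      also have "\<dots> \<le> ennreal (e / 2)" using t by (intro ennreal_leI) (simp add: field_simps)
      finally show "emeasure (poisson_clock t) {s0..} \<le> ennreal (e / 2)" .
    qed
    also have "\<dots> = (\<integral>\<^sup>+ s. ennreal (mehler_mass s x) \<partial>poisson_clock t) + ennreal e"
      using e by (simp add: add.assoc ennreal_plus[symmetric] del: ennreal_plus)
    also have "(\<integral>\<^sup>+ s. ennreal (mehler_mass s x) \<partial>poisson_clock t) = (\<integral>\<^sup>+ y. poisson_density t x y \<partial>lborel)"
      using t by (simp add: nn_integral_poisson_density lborel.sigma_finite_measure_axioms ball_average_lebesgue)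
    finally show ?thesis .
  qed
  moreover have "0 < e / (2 * exp (1 / kappa s0))" using e by simp
  ultimately show ?thesis by blast
qed


section \<open>From small balls to nontangential limits\<close>

text \<open>
  An inequality between two measures on small balls near the origin, with an error small compared with
  \<open>(norm z + r) ^ d\<close>, passes to their Poisson integrals.  Positivity is what makes it work: only
  the left-hand side has to be truncated, as on the right-hand side the truncated balls may be enlarged again.
  The measures on either side are sums with a multiple of Lebesgue measure, so that a density of either sign
  can be moved to the side where its coefficient is nonnegative.
\<close>

lemma poisson_comparison:
  fixes p n :: "'a::euclidean_space measure" and a b :: real
  assumes p: "sets p = sets borel" "(\<integral>\<^sup>+ y. ennreal (Phi y) \<partial>p) < \<infinity>"
    and n: "sets n = sets borel" "(\<integral>\<^sup>+ y. ennreal (Phi y) \<partial>n) < \<infinity>"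
    and dens: "\<And>\<epsilon>. 0 < \<epsilon> \<Longrightarrow> \<exists>\<delta>>0. \<forall>z r. 0 < r \<longrightarrow> norm z + r < \<delta> \<longrightarrow>
      emeasure p (ball z r) + ennreal a * emeasure lborel (ball z r)
        \<le> emeasure n (ball z r) + ennreal b * emeasure lborel (ball z r) + ennreal (\<epsilon> * (norm z + r) ^ DIM('a))"
    and \<alpha>: "0 < \<alpha>" and e: "0 < e"
  shows "\<exists>\<tau>>0. \<forall>t x. 0 < t \<longrightarrow> t < \<tau> \<longrightarrow> norm x < \<alpha> * t \<longrightarrow>
    (\<integral>\<^sup>+ y. poisson_density t x y \<partial>p) + ennreal a * (\<integral>\<^sup>+ y. poisson_density t x y \<partial>lborel)
      \<le> (\<integral>\<^sup>+ y. poisson_density t x y \<partial>n) + ennreal b * (\<integral>\<^sup>+ y. poisson_density t x y \<partial>lborel) + ennreal e"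
proof -
  let ?P = "\<lambda>t x m. \<integral>\<^sup>+ y. poisson_density t x y \<partial>m"
  obtain G where G: "0 \<le> G" "\<And>t (x::'a). 0 < t \<Longrightarrow> norm x < \<alpha> * t \<Longrightarrow>
      ball_average t x (\<lambda>z r. ennreal ((norm z + r) ^ DIM('a))) \<le> ennreal G"
    using ball_average_growth[OF \<alpha>, where 'a='a] by blast
  \<comment> \<open>Half of \<open>e\<close> is spent on the small balls, half on the tails.\<close>
  define \<epsilon> where "\<epsilon> = e / (2 * (G + 1))"
  have \<epsilon>: "0 < \<epsilon>" "\<epsilon> * G \<le> e / 2" using e G(1) by (auto simp: \<epsilon>_def field_simps)
  obtain \<delta> where \<delta>: "0 < \<delta>" "\<And>z r. 0 < r \<Longrightarrow> norm z + r < \<delta> \<Longrightarrow>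
      emeasure p (ball z r) + ennreal a * emeasure lborel (ball z r)
        \<le> emeasure n (ball z r) + ennreal b * emeasure lborel (ball z r) + ennreal (\<epsilon> * (norm z + r) ^ DIM('a))"
    using dens[OF \<epsilon>(1)] by blast
  \<comment> \<open>A centre with \<open>norm z \<le> \<eta>\<close> and a radius at most \<open>2 * \<eta>\<close> stay below \<open>\<delta>\<close>.\<close>
  define \<eta> where "\<eta> = min (\<delta> / 4) 1"
  have \<eta>: "0 < \<eta>" "\<eta> \<le> 1" "4 * \<eta> \<le> \<delta>" using \<delta>(1) by (auto simp: \<eta>_def)
  obtain C where C: "0 \<le> C" "\<And>t (x::'a) y. 0 < t \<Longrightarrow> norm x \<le> \<eta> / 16 \<Longrightarrow> \<eta> \<le> norm y \<Longrightarrow>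
      poisson_density t x y \<le> ennreal (C * t * Phi y)"
    using poisson_density_tail[OF \<eta>(1,2), where 'a='a] by blast
  define S where "S = (\<integral>\<^sup>+ y. ennreal (Phi y) \<partial>p) + ennreal a * (\<integral>\<^sup>+ y. ennreal (Phi (y :: 'a)) \<partial>lborel)"
  have "S < \<infinity>"
    using p(2) nn_integral_Phi_lborel[where 'a='a] by (simp add: S_def ennreal_mult_less_top)
  then obtain S' where S': "0 \<le> S'" "S = ennreal S'" by (cases S) auto
  define \<tau> where "\<tau> = min (\<eta> / (16 * \<alpha>)) (e / (2 * (C * S' + 1)))"
  have \<tau>: "0 < \<tau>" using \<eta> \<alpha> e C(1) S'(1) by (simp add: \<tau>_def add_nonneg_pos)
  have "?P t x p + ennreal a * ?P t x lborel \<le> ?P t x n + ennreal b * ?P t x lborel + ennreal e"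
    if t: "0 < t" "t < \<tau>" and x: "norm x < \<alpha> * t" for t and x :: 'a
  proof -
    have "\<alpha> * t \<le> \<eta> / 16" using t \<alpha> by (simp add: \<tau>_def field_simps)
    then have x': "norm x \<le> \<eta> / 16" using x by simp
    have sf: "sigma_finite_measure p" "sigma_finite_measure n" "sigma_finite_measure (lborel :: 'a measure)"
      using p n by (auto intro: sigma_finite_measure_if_Phi_integrable lborel.sigma_finite_measure_axioms)
    define T where "T m z r = emeasure m (ball z (min r (2 * \<eta>)))" for m :: "'a measure" and z r
    define R where "R m = (\<integral>\<^sup>+ y. poisson_density t x y * indicator {y. \<eta> \<le> norm y} y \<partial>m)" for m :: "'a measure"
    have trunc: "?P t x m \<le> ball_average t x (T m) + R m"
      if "sets m = sets borel" "(\<integral>\<^sup>+ y. ennreal (Phi y) \<partial>m) < \<infinity>" for m :: "'a measure"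
      unfolding T_def[abs_def] R_def using t x' \<eta> that by (intro poisson_truncation) auto
    have tail: "R m \<le> ennreal (C * t) * (\<integral>\<^sup>+ y. ennreal (Phi y) \<partial>m)" if "sets m = sets borel" for m :: "'a measure"
      unfolding R_def using that C(1) t C(2)[OF t(1) x'] by (intro nn_integral_poisson_tail_le) auto
    have T_meas: "(\<lambda>(z, r). T m z r) \<in> borel_measurable (borel \<Otimes>\<^sub>M borel)"
      if "sigma_finite_measure m" "sets m = sets borel" for m :: "'a measure"
      unfolding T_def using that by (rule measurable_emeasure_truncated_ball)
    have E_meas: "(\<lambda>(z, r). emeasure m (ball z r)) \<in> borel_measurable (borel \<Otimes>\<^sub>M borel)"
      if "sigma_finite_measure m" "sets m = sets borel" for m :: "'a measure"
      using that by (rule measurable_emeasure_ball)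
    have core: "ball_average t x (T p) + ennreal a * ball_average t x (T lborel)
        \<le> ?P t x n + ennreal b * ?P t x lborel + ennreal (e / 2)"
    proof -
      have "ball_average t x (T p) + ennreal a * ball_average t x (T lborel)
          = ball_average t x (\<lambda>z r. T p z r + ennreal a * T lborel z r)"
        by (rule ball_average_linear[symmetric]) (use T_meas sf p in auto)
      also have "\<dots> \<le> ball_average t x (\<lambda>z r. (emeasure n (ball z r) + ennreal b * emeasure lborel (ball z r))
          + ennreal \<epsilon> * ennreal ((norm z + r) ^ DIM('a)))"
      proof (rule ball_average_mono)
        fix z :: 'a and r :: real assume z: "norm z \<le> norm x" and r: "0 \<le> r"
        define \<rho> where "\<rho> = min r (2 * \<eta>)"
        show "T p z r + ennreal a * T lborel z r \<le> (emeasure n (ball z r) + ennreal b * emeasure lborel (ball z r))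
          + ennreal \<epsilon> * ennreal ((norm z + r) ^ DIM('a))"
        proof (cases "r = 0")
          case True
          then show ?thesis using \<eta> by (simp add: T_def)
        next
          case False
          then have \<rho>: "0 < \<rho>" "\<rho> \<le> r" using r \<eta> by (auto simp: \<rho>_def)
          have "norm z + \<rho> < \<delta>" using z x' \<eta> by (auto simp: \<rho>_def)
          then have "T p z r + ennreal a * T lborel z r
              \<le> emeasure n (ball z \<rho>) + ennreal b * emeasure lborel (ball z \<rho>) + ennreal (\<epsilon> * (norm z + \<rho>) ^ DIM('a))"
            unfolding T_def \<rho>_def[symmetric] by (rule \<delta>(2)[OF \<rho>(1)])
          also have "\<dots> \<le> emeasure n (ball z r) + ennreal b * emeasure lborel (ball z r) + ennreal (\<epsilon> * (norm z + r) ^ DIM('a))"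
            using \<rho> \<epsilon> n by (intro add_mono mult_left_mono emeasure_mono ennreal_leI power_mono) auto
          finally show ?thesis using \<epsilon> r by (simp add: ennreal_mult)
        qed
      qed
      also have "\<dots> = ball_average t x (\<lambda>z r. emeasure n (ball z r) + ennreal b * emeasure lborel (ball z r))
          + ennreal \<epsilon> * ball_average t x (\<lambda>z r. ennreal ((norm z + r) ^ DIM('a)))"
      proof (rule ball_average_linear)
        show "(\<lambda>(z, r). emeasure n (ball z r) + ennreal b * emeasure lborel (ball z r)) \<in> borel_measurable (borel \<Otimes>\<^sub>M borel)"
          using E_meas[OF sf(2) n(1)] E_meas[OF sf(3)] by (simp add: case_prod_beta)
      qed (simp add: case_prod_beta)
      also have "ball_average t x (\<lambda>z r. emeasure n (ball z r) + ennreal b * emeasure lborel (ball z r))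
          = ball_average t x (\<lambda>z r. emeasure n (ball z r)) + ennreal b * ball_average t x (\<lambda>z r. emeasure lborel (ball z r))"
        by (rule ball_average_linear) (use E_meas sf n in auto)
      also have "\<dots> = ?P t x n + ennreal b * ?P t x lborel"
        using t sf n by (simp add: nn_integral_poisson_density)
      also have "?P t x n + ennreal b * ?P t x lborel + ennreal \<epsilon> * ball_average t x (\<lambda>z r. ennreal ((norm z + r) ^ DIM('a)))
          \<le> ?P t x n + ennreal b * ?P t x lborel + ennreal (e / 2)"
      proof (rule add_left_mono)
        have "ennreal \<epsilon> * ball_average t x (\<lambda>z r. ennreal ((norm z + r) ^ DIM('a))) \<le> ennreal \<epsilon> * ennreal G"
          using G(2)[OF t(1) x] by (intro mult_left_mono) auto
        also have "\<dots> \<le> ennreal (e / 2)"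
          using \<epsilon> G(1) by (simp add: ennreal_mult'[symmetric] ennreal_leI)
        finally show "ennreal \<epsilon> * ball_average t x (\<lambda>z r. ennreal ((norm z + r) ^ DIM('a))) \<le> ennreal (e / 2)" .
      qed
      finally show ?thesis .
    qed
    have "R p + ennreal a * R lborel
        \<le> ennreal (C * t) * (\<integral>\<^sup>+ y. ennreal (Phi y) \<partial>p) + ennreal a * (ennreal (C * t) * (\<integral>\<^sup>+ y. ennreal (Phi (y :: 'a)) \<partial>lborel))"
      using tail p by (intro add_mono mult_left_mono) auto
    also have "\<dots> = ennreal (C * t) * S" by (simp add: S_def distrib_left mult.left_commute)
    also have "\<dots> = ennreal (C * t * S')" using C(1) t S' by (simp add: ennreal_mult'[symmetric])
    also have "\<dots> \<le> ennreal (e / 2)"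
    proof (rule ennreal_leI)
      have D: "0 < C * S' + 1" using C(1) S'(1) by (simp add: add_nonneg_pos)
      have "t * (C * S' + 1) \<le> e / 2" using t D by (simp add: \<tau>_def field_simps)
      moreover have "t * (C * S' + 1) = C * t * S' + t" by (simp add: algebra_simps)
      ultimately show "C * t * S' \<le> e / 2" using t by linarith
    qed
    finally have tails: "R p + ennreal a * R lborel \<le> ennreal (e / 2)" .
    have "?P t x p + ennreal a * ?P t x lborel
        \<le> (ball_average t x (T p) + R p) + ennreal a * (ball_average t x (T lborel) + R lborel)"
      using trunc p nn_integral_Phi_lborel[where 'a='a] by (intro add_mono mult_left_mono) auto
    also have "\<dots> = (ball_average t x (T p) + ennreal a * ball_average t x (T lborel)) + (R p + ennreal a * R lborel)"
      by (simp add: distrib_left ac_simps)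
    also have "\<dots> \<le> (?P t x n + ennreal b * ?P t x lborel + ennreal (e / 2)) + ennreal (e / 2)"
      by (intro add_mono core tails)
    also have "\<dots> = ?P t x n + ennreal b * ?P t x lborel + ennreal e"
      using e by (simp add: add.assoc ennreal_plus[symmetric] del: ennreal_plus)
    finally show ?thesis .
  qed
  with \<tau> show ?thesis by blast
qed

text \<open>
  Two-sided comparison of \<open>p\<close> with \<open>n + c * lborel\<close>; the negative part of \<open>c\<close> is carried over to \<open>p\<close>.
\<close>

lemma poisson_signed_limit:
  fixes p n :: "'a::euclidean_space measure" and c :: real
  assumes p: "sets p = sets borel" "(\<integral>\<^sup>+ y. ennreal (Phi y) \<partial>p) < \<infinity>"
    and n: "sets n = sets borel" "(\<integral>\<^sup>+ y. ennreal (Phi y) \<partial>n) < \<infinity>"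
    and dens: "\<And>\<epsilon>. 0 < \<epsilon> \<Longrightarrow> \<exists>\<delta>>0. \<forall>z r. 0 < r \<longrightarrow> norm z + r < \<delta> \<longrightarrow>
      \<bar>measure p (ball z r) - measure n (ball z r) - c * measure lborel (ball z r)\<bar> \<le> \<epsilon> * (norm z + r) ^ DIM('a)"
    and \<alpha>: "0 < \<alpha>" and e: "0 < e"
  shows "\<exists>\<tau>>0. \<forall>t x. 0 < t \<longrightarrow> t < \<tau> \<longrightarrow> norm x < \<alpha> * t \<longrightarrow>
    \<bar>enn2real (\<integral>\<^sup>+ y. poisson_density t x y \<partial>p) - enn2real (\<integral>\<^sup>+ y. poisson_density t x y \<partial>n) - c\<bar> \<le> e"
proof -
  define a b where "a = max 0 (- c)" and "b = max 0 c"
  have ab: "0 \<le> a" "0 \<le> b" "b - a = c" by (auto simp: a_def b_def)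
  have fin: "emeasure m (ball z r) = ennreal (measure m (ball z r))"
    if m: "sets m = sets borel" "(\<integral>\<^sup>+ y. ennreal (Phi y) \<partial>m) < \<infinity>" for m :: "'a measure" and z r
    using emeasure_ball_finite_if_Phi_integrable[OF m, of z r] by (simp add: emeasure_eq_ennreal_measure)
  note finL = fin[OF sets_lborel nn_integral_Phi_lborel]
  have one: "\<exists>\<delta>>0. \<forall>z r. 0 < r \<longrightarrow> norm z + r < \<delta> \<longrightarrow>
      emeasure p (ball z r) + ennreal a * emeasure lborel (ball z r)
        \<le> emeasure n (ball z r) + ennreal b * emeasure lborel (ball z r) + ennreal (\<epsilon> * (norm z + r) ^ DIM('a)) \<and>
      emeasure n (ball z r) + ennreal b * emeasure lborel (ball z r)
        \<le> emeasure p (ball z r) + ennreal a * emeasure lborel (ball z r) + ennreal (\<epsilon> * (norm z + r) ^ DIM('a))"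
    if \<epsilon>: "0 < \<epsilon>" for \<epsilon>
  proof -
    obtain \<delta> where \<delta>: "0 < \<delta>" "\<And>z r. 0 < r \<Longrightarrow> norm z + r < \<delta> \<Longrightarrow>
      \<bar>measure p (ball z r) - measure n (ball z r) - c * measure lborel (ball z r)\<bar> \<le> \<epsilon> * (norm z + r) ^ DIM('a)"
      using dens[OF \<epsilon>] by blast
    have "measure p (ball z r) + a * measure lborel (ball z r)
        \<le> measure n (ball z r) + b * measure lborel (ball z r) + \<epsilon> * (norm z + r) ^ DIM('a) \<and>
      measure n (ball z r) + b * measure lborel (ball z r)
        \<le> measure p (ball z r) + a * measure lborel (ball z r) + \<epsilon> * (norm z + r) ^ DIM('a)"
      if "0 < r" "norm z + r < \<delta>" for z :: 'a and r
      using \<delta>(2)[OF that] unfolding ab(3)[symmetric] left_diff_distrib by linarith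
    then show ?thesis
      using \<delta>(1) \<epsilon> ab by (intro exI[of _ \<delta>])
        (auto simp: fin[OF p] fin[OF n] finL ennreal_mult'[symmetric] ennreal_plus[symmetric] simp del: ennreal_plus intro!: ennreal_leI)
  qed
  have one1: "\<exists>\<delta>>0. \<forall>z r. 0 < r \<longrightarrow> norm z + r < \<delta> \<longrightarrow>
      emeasure p (ball z r) + ennreal a * emeasure lborel (ball z r)
        \<le> emeasure n (ball z r) + ennreal b * emeasure lborel (ball z r) + ennreal (\<epsilon> * (norm z + r) ^ DIM('a))"
    if \<epsilon>: "0 < \<epsilon>" for \<epsilon>
    using one[OF \<epsilon>] by (elim ex_forward conj_forward all_forward imp_forward) (assumption | erule conjunct1)+
  have one2: "\<exists>\<delta>>0. \<forall>z r. 0 < r \<longrightarrow> norm z + r < \<delta> \<longrightarrow>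
      emeasure n (ball z r) + ennreal b * emeasure lborel (ball z r)
        \<le> emeasure p (ball z r) + ennreal a * emeasure lborel (ball z r) + ennreal (\<epsilon> * (norm z + r) ^ DIM('a))"
    if \<epsilon>: "0 < \<epsilon>" for \<epsilon>
    using one[OF \<epsilon>] by (elim ex_forward conj_forward all_forward imp_forward) (assumption | erule conjunct2)+
  obtain e1 where e1: "0 < e1" "e1 + \<bar>c\<bar> * e1 \<le> e"
  proof
    show "0 < e / (1 + \<bar>c\<bar>)" using e by simp
    have "e / (1 + \<bar>c\<bar>) + \<bar>c\<bar> * (e / (1 + \<bar>c\<bar>)) = (1 + \<bar>c\<bar>) * (e / (1 + \<bar>c\<bar>))"
      by (simp only: distrib_right mult_1)
    also have "\<dots> = e" using abs_ge_zero[of c] by (simp del: abs_ge_zero)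
    finally show "e / (1 + \<bar>c\<bar>) + \<bar>c\<bar> * (e / (1 + \<bar>c\<bar>)) \<le> e" by simp
  qed
  obtain \<tau>1 where \<tau>1: "0 < \<tau>1" "\<And>t x. 0 < t \<Longrightarrow> t < \<tau>1 \<Longrightarrow> norm x < \<alpha> * t \<Longrightarrow>
    (\<integral>\<^sup>+ y. poisson_density t x y \<partial>p) + ennreal a * (\<integral>\<^sup>+ y. poisson_density t x y \<partial>lborel)
      \<le> (\<integral>\<^sup>+ y. poisson_density t x y \<partial>n) + ennreal b * (\<integral>\<^sup>+ y. poisson_density t x y \<partial>lborel) + ennreal e1"
    using poisson_comparison[OF p n one1 \<alpha> e1(1)] by blast
  obtain \<tau>2 where \<tau>2: "0 < \<tau>2" "\<And>t x. 0 < t \<Longrightarrow> t < \<tau>2 \<Longrightarrow> norm x < \<alpha> * t \<Longrightarrow>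
    (\<integral>\<^sup>+ y. poisson_density t x y \<partial>n) + ennreal b * (\<integral>\<^sup>+ y. poisson_density t x y \<partial>lborel)
      \<le> (\<integral>\<^sup>+ y. poisson_density t x y \<partial>p) + ennreal a * (\<integral>\<^sup>+ y. poisson_density t x y \<partial>lborel) + ennreal e1"
    using poisson_comparison[OF n p one2 \<alpha> e1(1)] by blast
  obtain \<tau>3 where \<tau>3: "0 < \<tau>3" "\<And>t x. 0 < t \<Longrightarrow> t < \<tau>3 \<Longrightarrow> norm (x :: 'a) \<le> 1 \<Longrightarrow>
    1 \<le> (\<integral>\<^sup>+ y. poisson_density t x y \<partial>lborel) + ennreal e1"
    using poisson_of_one[OF e1(1), where 'a='a] by blast
  define \<tau> where "\<tau> = min (min \<tau>1 \<tau>2) (min \<tau>3 (1 / (16 * \<alpha>)))"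
  have "\<bar>enn2real (\<integral>\<^sup>+ y. poisson_density t x y \<partial>p) - enn2real (\<integral>\<^sup>+ y. poisson_density t x y \<partial>n) - c\<bar> \<le> e"
    if t: "0 < t" "t < \<tau>" and x: "norm x < \<alpha> * t" for t x
  proof -
    have "\<alpha> * t \<le> 1 / 16" using t \<alpha> by (simp add: \<tau>_def field_simps)
    then have x': "norm x \<le> 1 / 16" using x by simp
    define X Y I where "X = enn2real (\<integral>\<^sup>+ y. poisson_density t x y \<partial>p)"
      and "Y = enn2real (\<integral>\<^sup>+ y. poisson_density t x y \<partial>n)"
      and "I = enn2real (\<integral>\<^sup>+ y. poisson_density t x y \<partial>lborel)"
    have P: "(\<integral>\<^sup>+ y. poisson_density t x y \<partial>p) = ennreal X" "(\<integral>\<^sup>+ y. poisson_density t x y \<partial>n) = ennreal Y"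
      "(\<integral>\<^sup>+ y. poisson_density t x y \<partial>lborel) = ennreal I"
      unfolding X_def Y_def I_def
      using nn_integral_poisson_density_finite[OF p t(1) x'] nn_integral_poisson_density_finite[OF n t(1) x']
        nn_integral_poisson_density_finite[OF sets_lborel nn_integral_Phi_lborel t(1) x'] by auto
    have XYI: "0 \<le> X" "0 \<le> Y" "0 \<le> I" by (simp_all add: X_def Y_def I_def)
    have "ennreal I \<le> 1"
      using t ball_average_lebesgue_le_1[of t x]
      by (simp add: P(3)[symmetric] nn_integral_poisson_density lborel.sigma_finite_measure_axioms)
    moreover have "1 \<le> ennreal I + ennreal e1"
      using \<tau>3(2)[of t x] t x' by (simp add: P \<tau>_def)
    ultimately have I: "\<bar>I - 1\<bar> \<le> e1"
      using XYI e1(1) by (auto simp: ennreal_plus[symmetric] ennreal_1[symmetric] simp del: ennreal_plus ennreal_1)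
    have "X + a * I \<le> Y + b * I + e1"
      using \<tau>1(2)[of t x] t x XYI ab e1(1)
      by (simp add: P \<tau>_def ennreal_mult'[symmetric] ennreal_plus[symmetric] del: ennreal_plus)
    moreover have "Y + b * I \<le> X + a * I + e1"
      using \<tau>2(2)[of t x] t x XYI ab e1(1)
      by (simp add: P \<tau>_def ennreal_mult'[symmetric] ennreal_plus[symmetric] del: ennreal_plus)
    moreover have "c * I = b * I - a * I" unfolding ab(3)[symmetric] by (rule left_diff_distrib)
    ultimately have "\<bar>X - Y - c * I\<bar> \<le> e1" by linarith
    moreover have "\<bar>c * I - c\<bar> \<le> \<bar>c\<bar> * e1"
    proof -
      have "c * I - c = c * (I - 1)" by (simp add: algebra_simps)
      then show ?thesis using I by (simp add: abs_mult mult_left_mono)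
    qed
    ultimately have "\<bar>X - Y - c\<bar> \<le> e1 + \<bar>c\<bar> * e1" by linarith
    then show ?thesis using e1(2) unfolding X_def Y_def by linarith
  qed
  moreover have "0 < \<tau>" using \<tau>1(1) \<tau>2(1) \<tau>3(1) \<alpha> by (simp add: \<tau>_def)
  ultimately show ?thesis by blast
qed


section \<open>The Jordan decomposition and the limit for complex measures\<close>

lemma sets_jordan_pos [simp]: "sets (jordan_pos \<sigma>) = sets borel"
  unfolding jordan_pos_def using sets.sigma_sets_eq[of borel] by (simp add: sets_measure_of_conv)

lemma sets_variation_measure: "sets (variation_measure \<nu>) = sets borel"
  unfolding variation_measure_def using sets.sigma_sets_eq[of borel] by (simp add: sets_measure_of_conv)

lemma upper_variation_le_total_variation:
  assumes "\<And>F. \<sigma> F \<le> cmod (\<nu> F)"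
  shows "upper_variation \<sigma> E \<le> total_variation \<nu> E"
  unfolding upper_variation_def
proof (rule SUP_least)
  fix F assume F: "F \<in> {F \<in> sets borel. bounded F \<and> F \<subseteq> E}"
  have "ennreal (\<sigma> F) \<le> (\<Sum>A\<in>{F}. ennreal (cmod (\<nu> A)))"
    using assms[of F] by (simp add: ennreal_leI)
  also have "\<dots> \<le> total_variation \<nu> E"
    unfolding total_variation_def by (rule SUP_upper) (use F in auto)
  finally show "ennreal (\<sigma> F) \<le> total_variation \<nu> E" .
qed

lemma nn_integral_jordan_pos_le:
  assumes \<nu>: "lf_complex_measure \<nu>" and \<sigma>: "lf_signed_measure \<sigma>" and le: "\<And>F. \<sigma> F \<le> cmod (\<nu> F)"
    and f: "f \<in> borel_measurable borel"
  shows "(\<integral>\<^sup>+ y. f y \<partial>jordan_pos \<sigma>) \<le> (\<integral>\<^sup>+ y. f y \<partial>variation_measure \<nu>)"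
proof (rule nn_integral_mono_measure)
  show "jordan_pos \<sigma> \<le> variation_measure \<nu>"
    by (subst le_measure)
      (auto simp: sets_variation_measure le_fun_def emeasure_jordan_pos[OF \<sigma>] emeasure_variation_measure[OF \<nu>]
        upper_variation_le_total_variation[OF le] emeasure_notin_sets)
qed (auto simp: sets_variation_measure f)

text \<open>
  For \<open>F \<subseteq> E\<close> write \<open>\<sigma> F = \<sigma> E - \<sigma> (E - F)\<close> and take the supremum over \<open>F\<close>.
\<close>

lemma measure_jordan_le:
  assumes \<sigma>: "lf_signed_measure \<sigma>" and \<sigma>': "lf_signed_measure (\<lambda>E. - \<sigma> E)"
    and E: "E \<in> sets borel" "bounded E"
    and fin: "emeasure (jordan_pos \<sigma>) E < \<infinity>" "emeasure (jordan_neg \<sigma>) E < \<infinity>"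
  shows "measure (jordan_pos \<sigma>) E \<le> \<sigma> E + measure (jordan_neg \<sigma>) E"
proof -
  have neg: "- \<sigma> G \<le> measure (jordan_neg \<sigma>) E" if G: "G \<in> sets borel" "bounded G" "G \<subseteq> E" for G
  proof -
    have "ennreal (- \<sigma> G) \<le> upper_variation (\<lambda>E. - \<sigma> E) E"
      unfolding upper_variation_def using G by (intro SUP_upper) auto
    also have "\<dots> = ennreal (measure (jordan_neg \<sigma>) E)"
      using emeasure_jordan_pos[OF \<sigma>' E(1)] fin(2)
      by (subst emeasure_eq_ennreal_measure[symmetric]) (auto simp: jordan_neg_def)
    finally show ?thesis by (simp add: ennreal_le_iff)
  qed
  have bound: "\<sigma> F \<le> \<sigma> E + measure (jordan_neg \<sigma>) E" if F: "F \<in> sets borel" "bounded F" "F \<subseteq> E" for F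
  proof -
    have "\<sigma> (F \<union> (E - F)) = \<sigma> F + \<sigma> (E - F)"
      using F E by (intro lf_signed_measure_Un[OF \<sigma>]) (auto intro: bounded_subset)
    moreover have "F \<union> (E - F) = E" using F by auto
    moreover have "- \<sigma> (E - F) \<le> measure (jordan_neg \<sigma>) E"
      using F E by (intro neg) (auto intro: bounded_subset)
    ultimately show ?thesis by simp
  qed
  have "ennreal (measure (jordan_pos \<sigma>) E) = upper_variation \<sigma> E"
    using emeasure_jordan_pos[OF \<sigma> E(1)] fin(1) by (subst emeasure_eq_ennreal_measure[symmetric]) auto
  also have "\<dots> \<le> ennreal (\<sigma> E + measure (jordan_neg \<sigma>) E)"
    unfolding upper_variation_def by (rule SUP_least) (auto intro!: ennreal_leI bound)
  finally have "ennreal (measure (jordan_pos \<sigma>) E) \<le> ennreal (\<sigma> E + measure (jordan_neg \<sigma>) E)" .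
  moreover have "0 \<le> \<sigma> E + measure (jordan_neg \<sigma>) E"
    using bound[of "{}"] lf_signed_measure_empty[OF \<sigma>] by simp
  ultimately show ?thesis by (simp add: ennreal_le_iff)
qed

lemma lf_signed_measure_uminus: "lf_signed_measure \<sigma> \<Longrightarrow> lf_signed_measure (\<lambda>E. - \<sigma> E)"
  unfolding lf_signed_measure_def by (auto intro: sums_minus)

text \<open>
  Finiteness of the two parts is assumed here; for measures in \<^const>\<open>M_Phi\<close> it follows from
  \<open>upper_variation_le_total_variation\<close>, as \<^const>\<open>Phi\<close> is bounded below on balls.
\<close>

lemma jordan_decomposition:
  assumes \<sigma>: "lf_signed_measure \<sigma>" and E: "E \<in> sets borel" "bounded E"
    and fin: "emeasure (jordan_pos \<sigma>) E < \<infinity>" "emeasure (jordan_neg \<sigma>) E < \<infinity>"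
  shows "measure (jordan_pos \<sigma>) E - measure (jordan_neg \<sigma>) E = \<sigma> E"
proof -
  note \<sigma>' = lf_signed_measure_uminus[OF \<sigma>]
  have "measure (jordan_pos \<sigma>) E \<le> \<sigma> E + measure (jordan_neg \<sigma>) E"
    by (rule measure_jordan_le[OF \<sigma> \<sigma>' E fin])
  moreover have "measure (jordan_neg \<sigma>) E \<le> - \<sigma> E + measure (jordan_pos \<sigma>) E"
    using measure_jordan_le[OF \<sigma>' _ E] \<sigma> fin by (simp add: jordan_neg_def)
  ultimately show ?thesis by linarith
qed

text \<open>
  Applied to \<open>\<sigma> = Re \<nu>\<close> and \<open>\<sigma> = Im \<nu>\<close>.
\<close>

lemma signed_part_nontangential_limit:
  fixes \<nu> :: "'a::euclidean_space set \<Rightarrow> complex" and \<sigma> :: "'a set \<Rightarrow> real" and c :: real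
  assumes \<nu>: "\<nu> \<in> M_Phi" and \<sigma>: "lf_signed_measure \<sigma>" and le: "\<And>F. \<bar>\<sigma> F\<bar> \<le> cmod (\<nu> F)"
    and dens: "\<And>\<epsilon>. 0 < \<epsilon> \<Longrightarrow> \<exists>\<delta>>0. \<forall>z r. 0 < r \<longrightarrow> norm z + r < \<delta> \<longrightarrow>
      \<bar>\<sigma> (ball z r) - c * measure lborel (ball z r)\<bar> \<le> \<epsilon> * (norm z + r) ^ DIM('a)"
    and \<alpha>: "0 < \<alpha>" and e: "0 < e"
  shows "\<exists>\<tau>>0. \<forall>t x. 0 < t \<longrightarrow> t < \<tau> \<longrightarrow> norm x < \<alpha> * t \<longrightarrow>
    cmod ((LINT y|jordan_pos \<sigma>. complex_of_real (poisson_hermite_kernel t x y))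
      - (LINT y|jordan_neg \<sigma>. complex_of_real (poisson_hermite_kernel t x y)) - of_real c) \<le> e"
proof -
  have \<nu>': "lf_complex_measure \<nu>" "(\<integral>\<^sup>+ y. ennreal (Phi y) \<partial>variation_measure \<nu>) < \<infinity>"
    using \<nu> by (auto simp: M_Phi_def)
  note \<sigma>' = lf_signed_measure_uminus[OF \<sigma>]
  have le': "\<sigma> F \<le> cmod (\<nu> F)" "- \<sigma> F \<le> cmod (\<nu> F)" for F using le[of F] by linarith+
  have p: "sets (jordan_pos \<sigma>) = sets borel" "(\<integral>\<^sup>+ y. ennreal (Phi y) \<partial>jordan_pos \<sigma>) < \<infinity>"
    using nn_integral_jordan_pos_le[OF \<nu>'(1) \<sigma> le'(1), of "\<lambda>y. ennreal (Phi y)"] \<nu>'(2) by (auto intro: order_le_less_trans)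
  have n: "sets (jordan_neg \<sigma>) = sets borel" "(\<integral>\<^sup>+ y. ennreal (Phi y) \<partial>jordan_neg \<sigma>) < \<infinity>"
    unfolding jordan_neg_def
    using nn_integral_jordan_pos_le[OF \<nu>'(1) \<sigma>' le'(2), of "\<lambda>y. ennreal (Phi y)"] \<nu>'(2) by (auto intro: order_le_less_trans)
  have diff: "measure (jordan_pos \<sigma>) (ball z r) - measure (jordan_neg \<sigma>) (ball z r) = \<sigma> (ball z r)" for z r
    by (rule jordan_decomposition[OF \<sigma>])
      (auto simp: emeasure_ball_finite_if_Phi_integrable[OF p, simplified] emeasure_ball_finite_if_Phi_integrable[OF n, simplified])
  have kernel: "(LINT y|m. complex_of_real (poisson_hermite_kernel t x y))
      = of_real (enn2real (\<integral>\<^sup>+ y. poisson_density t x y \<partial>m))"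
    if "sets m = sets borel" "0 < t" for m :: "'a measure" and t x
  proof -
    have "poisson_hermite_kernel t x \<in> borel_measurable m"
      using poisson_hermite_kernel_measurable[OF that(2)] by (simp add: measurable_cong_sets[OF that(1) refl])
    then have "(LINT y|m. poisson_hermite_kernel t x y) = enn2real (\<integral>\<^sup>+ y. ennreal (poisson_hermite_kernel t x y) \<partial>m)"
      by (rule integral_eq_nn_integral) (simp add: poisson_hermite_kernel_eq(2)[OF that(2)])
    then show ?thesis by (simp add: poisson_hermite_kernel_eq(1)[OF that(2)])
  qed
  obtain \<tau> where \<tau>: "0 < \<tau>" "\<And>t x. 0 < t \<Longrightarrow> t < \<tau> \<Longrightarrow> norm x < \<alpha> * t \<Longrightarrow>
    \<bar>enn2real (\<integral>\<^sup>+ y. poisson_density t x y \<partial>jordan_pos \<sigma>) - enn2real (\<integral>\<^sup>+ y. poisson_density t x y \<partial>jordan_neg \<sigma>) - c\<bar> \<le> e"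
    using poisson_signed_limit[OF p n _ \<alpha> e, of c] dens unfolding diff by blast
  have "cmod ((LINT y|jordan_pos \<sigma>. complex_of_real (poisson_hermite_kernel t x y))
      - (LINT y|jordan_neg \<sigma>. complex_of_real (poisson_hermite_kernel t x y)) - of_real c) \<le> e"
    if "0 < t" "t < \<tau>" "norm x < \<alpha> * t" for t x
    using \<tau>(2)[OF that] unfolding kernel[OF p(1) that(1)] kernel[OF n(1) that(1)] of_real_diff[symmetric] norm_of_real .
  with \<tau>(1) show ?thesis by blast
qed

lemma sigma_point_zeroD:
  fixes \<nu> :: "'a::euclidean_space set \<Rightarrow> complex"
  assumes "sigma_point_zero \<nu> l" and \<epsilon>: "0 < \<epsilon>"
  shows "\<exists>\<delta>>0. \<forall>z r. 0 < r \<longrightarrow> norm z + r < \<delta> \<longrightarrow>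
    cmod (minus_lebesgue \<nu> l (ball z r)) \<le> \<epsilon> * (norm z + r) ^ DIM('a)"
proof -
  have "eventually (\<lambda>q. dist (case q of (x, r) \<Rightarrow> cmod (minus_lebesgue \<nu> l (ball x r)) / (norm x + r) ^ DIM('a)) 0 < \<epsilon>)
      (at (0, 0) within UNIV \<times> {0<..})"
    using assms unfolding sigma_point_zero_def by (rule tendstoD)
  then obtain \<delta> where \<delta>: "0 < \<delta>" "\<And>z r. 0 < r \<Longrightarrow> dist (z, r) (0, 0) < \<delta> \<Longrightarrow>
      \<bar>cmod (minus_lebesgue \<nu> l (ball z r)) / (norm z + r) ^ DIM('a)\<bar> < \<epsilon>"
    unfolding eventually_at by (auto simp: dist_real_def)
  have "cmod (minus_lebesgue \<nu> l (ball z r)) \<le> \<epsilon> * (norm z + r) ^ DIM('a)"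
    if r: "0 < r" and zr: "norm z + r < \<delta>" for z :: 'a and r
  proof -
    have "dist (z, r) (0, 0) \<le> norm z + r"
      using r sqrt_sum_squares_le_sum[of "norm z" r] by (simp add: dist_prod_def)
    then have "\<bar>cmod (minus_lebesgue \<nu> l (ball z r)) / (norm z + r) ^ DIM('a)\<bar> < \<epsilon>"
      using \<delta>(2)[OF r] zr by simp
    moreover have "0 < (norm z + r) ^ DIM('a)" using r by (simp add: add_nonneg_pos)
    ultimately show ?thesis by (simp add: divide_less_eq)
  qed
  with \<delta>(1) show ?thesis by blast
qed

lemma poisson_hermite_nontangential_limit:
  fixes \<nu> :: "'a::euclidean_space set \<Rightarrow> complex" and l :: complex
  assumes \<nu>: "\<nu> \<in> M_Phi" and l: "sigma_point_zero \<nu> l" and \<alpha>: "0 < \<alpha>"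
  shows "nontangential_limit_zero \<alpha> (\<lambda>t x. poisson_hermite t \<nu> x) l"
  unfolding nontangential_limit_zero_def
proof (rule tendstoI)
  fix e :: real assume e: "0 < e"
  then have e4: "0 < e / 4" by simp
  have lf: "lf_signed_measure (\<lambda>E. Re (\<nu> E))" "lf_signed_measure (\<lambda>E. Im (\<nu> E))"
    using \<nu> by (auto simp: M_Phi_def lf_complex_measure_def)
  have re: "Re (minus_lebesgue \<nu> l E) = Re (\<nu> E) - Re l * measure lborel E"
    and im: "Im (minus_lebesgue \<nu> l E) = Im (\<nu> E) - Im l * measure lborel E" for E
    by (simp_all add: minus_lebesgue_def)
  define J where "J \<sigma> t x = (LINT y|jordan_pos \<sigma>. complex_of_real (poisson_hermite_kernel t x y))
      - (LINT y|jordan_neg \<sigma>. complex_of_real (poisson_hermite_kernel t x y))" for \<sigma> :: "'a set \<Rightarrow> real" and t and x :: 'a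
  have "\<exists>\<tau>>0. \<forall>t x. 0 < t \<longrightarrow> t < \<tau> \<longrightarrow> norm x < \<alpha> * t \<longrightarrow> cmod (J (\<lambda>E. Re (\<nu> E)) t x - of_real (Re l)) \<le> e / 4"
    unfolding J_def
  proof (rule signed_part_nontangential_limit[OF \<nu> lf(1) abs_Re_le_cmod _ \<alpha> e4])
    show "\<exists>\<delta>>0. \<forall>z r. 0 < r \<longrightarrow> norm z + r < \<delta> \<longrightarrow>
        \<bar>Re (\<nu> (ball z r)) - Re l * measure lborel (ball z r)\<bar> \<le> \<epsilon> * (norm z + r) ^ DIM('a)" if "0 < \<epsilon>" for \<epsilon>
      using sigma_point_zeroD[OF l that] unfolding re[symmetric] by (meson abs_Re_le_cmod order_trans)
  qed
  then obtain \<tau>1 where \<tau>1: "0 < \<tau>1" "\<And>t x. 0 < t \<Longrightarrow> t < \<tau>1 \<Longrightarrow> norm x < \<alpha> * t \<Longrightarrow>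
      cmod (J (\<lambda>E. Re (\<nu> E)) t x - of_real (Re l)) \<le> e / 4" by blast
  have "\<exists>\<tau>>0. \<forall>t x. 0 < t \<longrightarrow> t < \<tau> \<longrightarrow> norm x < \<alpha> * t \<longrightarrow> cmod (J (\<lambda>E. Im (\<nu> E)) t x - of_real (Im l)) \<le> e / 4"
    unfolding J_def
  proof (rule signed_part_nontangential_limit[OF \<nu> lf(2) abs_Im_le_cmod _ \<alpha> e4])
    show "\<exists>\<delta>>0. \<forall>z r. 0 < r \<longrightarrow> norm z + r < \<delta> \<longrightarrow>
        \<bar>Im (\<nu> (ball z r)) - Im l * measure lborel (ball z r)\<bar> \<le> \<epsilon> * (norm z + r) ^ DIM('a)" if "0 < \<epsilon>" for \<epsilon>
      using sigma_point_zeroD[OF l that] unfolding im[symmetric] by (meson abs_Im_le_cmod order_trans)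
  qed
  then obtain \<tau>2 where \<tau>2: "0 < \<tau>2" "\<And>t x. 0 < t \<Longrightarrow> t < \<tau>2 \<Longrightarrow> norm x < \<alpha> * t \<Longrightarrow>
      cmod (J (\<lambda>E. Im (\<nu> E)) t x - of_real (Im l)) \<le> e / 4" by blast
  have "cmod (poisson_hermite t \<nu> x - l) < e"
    if t: "0 < t" "t < min \<tau>1 \<tau>2" and x: "norm x < \<alpha> * t" for t x
  proof -
    have "poisson_hermite t \<nu> x = J (\<lambda>E. Re (\<nu> E)) t x + \<i> * J (\<lambda>E. Im (\<nu> E)) t x"
      by (simp add: poisson_hermite_def complex_measure_integral_def J_def)
    moreover have "l = of_real (Re l) + \<i> * of_real (Im l)" by (simp add: complex_eq)
    ultimately have "poisson_hermite t \<nu> x - l = (J (\<lambda>E. Re (\<nu> E)) t x - of_real (Re l)) + \<i> * (J (\<lambda>E. Im (\<nu> E)) t x - of_real (Im l))"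
      by (simp add: algebra_simps)
    then have "cmod (poisson_hermite t \<nu> x - l)
        \<le> cmod (J (\<lambda>E. Re (\<nu> E)) t x - of_real (Re l)) + cmod (\<i> * (J (\<lambda>E. Im (\<nu> E)) t x - of_real (Im l)))"
      by (metis norm_triangle_ineq)
    also have "\<dots> \<le> e / 4 + e / 4"
      using \<tau>1(2)[of t x] \<tau>2(2)[of t x] t x by (intro add_mono) (auto simp: norm_mult)
    finally show ?thesis using e by simp
  qed
  note small = this
  show "eventually (\<lambda>q. dist (case q of (t, x) \<Rightarrow> poisson_hermite t \<nu> x) l < e)
      (at (0, 0) within {(t, x). 0 < t \<and> norm x < \<alpha> * t})"
    unfolding eventually_at
  proof (intro exI[of _ "min \<tau>1 \<tau>2"] conjI ballI impI)
    fix q :: "real \<times> 'a"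
    assume q: "q \<in> {(t, x). 0 < t \<and> norm x < \<alpha> * t}" "q \<noteq> (0, 0) \<and> dist q (0, 0) < min \<tau>1 \<tau>2"
    obtain t x where tx: "q = (t, x)" by (cases q)
    have "\<bar>t\<bar> \<le> dist q (0, 0)" using dist_fst_le[of q "(0, 0)"] by (simp add: tx dist_real_def)
    then have "t < min \<tau>1 \<tau>2" using q(2) by linarith
    then show "dist (case q of (t, x) \<Rightarrow> poisson_hermite t \<nu> x) l < e"
      using small[of t x] q(1) unfolding tx by (simp add: dist_norm)
  qed (use \<tau>1(1) \<tau>2(1) in simp)
qed

theorem theorem3p3:
  fixes \<nu> :: "'a::euclidean_space set \<Rightarrow> complex" and l :: complex
  assumes "\<nu> \<in> M_Phi"
    and "sigma_point_zero \<nu> l"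
  shows "(DIM('a) \<in> {1, 2, 3, 4} \<longrightarrow>
            (\<forall>\<alpha>>0. nontangential_limit_zero \<alpha> (\<lambda>t x. poisson_hermite t \<nu> x) l)) \<and>
         (DIM('a) \<ge> 5 \<longrightarrow>
            ((\<lambda>r. total_variation (minus_lebesgue \<nu> l) (ball 0 r) / ennreal (r ^ (DIM('a) - 4)))
               \<longlongrightarrow> 0) (at_right 0) \<longrightarrow>
            (\<forall>\<alpha>>0. nontangential_limit_zero \<alpha> (\<lambda>t x. poisson_hermite t \<nu> x) l))"
  using poisson_hermite_nontangential_limit[OF assms] by blast

end
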